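(* Suppose that $\Omega_{\rm a}\cup\Omega_{\rm i}\subset{\rm int}(\Omega)$. If $\mathscr E_{\rm ac}$ is patch test consistent, i.e. $\langle\delta\mathscr E_{\rm ac}(y_{\mathsf F}),u_h\rangle=0$ for all $u_h\in\mathscr U_h$ and all $\mathsf F\in\mathbb R^{2\times2}$, then $$\frac1{|\Omega|}\int_\Omega\Sigma_{\rm ac}(y_{\mathsf F})\,dx=\partial W(\mathsf F)\qquad\text{for all }\mathsf F\in\mathbb R^{2\times2}.$$
   Context: **Atomistic model.** Let $N\in\mathbb N$, $\varepsilon=1/N$, $\Omega=(-1,1]^2$, $\mathscr L=\varepsilon\{-N+1,\dots,N\}^2$, $\mathscr L^\#=\varepsilon\mathbb Z^2$. For $A\subset\mathbb R^2$ let $A^\#=\bigcup_{\xi\in2\mathbb Z^2}(\xi+A)$. $\mathscr U$ is the space of $2\mathbb Z^2$-periodic $u:\mathscr L^\#\to\mathbb R^2$; $y_{\mathsf A}(x)=\mathsf Ax$; $\mathscr Y=\{y:\mathscr L^\#\to\mathbb R^2:y-y_{\mathsf A}\in\mathscr U\text{ for some }\mathsf A\in\mathbb R^{2\times2}\}$. $D_rv(x)=\varepsilon^{-1}(v(x+\varepsilon r)-v(x))$; $\mathscr R\subset\mathbb Z^2\setminus\{0\}$ finite; $D_{\mathscr R}y(x)=(D_ry(x))_{r\in\mathscr R}$. $V\in C^2((\mathbb R^2)^{\mathscr R})$ has globally bounded second partial derivatives; $\partial_rV=\partial V/\partial g_r\in\mathbb R^2$. $W(\mathsf F)=V((\mathsf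 Fr)_{r\in\mathscr R})$, and $\partial W(\mathsf F)\in\mathbb R^{2\times2}$ is its gradient. $\langle\delta\mathscr E(y),z\rangle=\frac{d}{dt}\mathscr E(y+tz)|_{t=0}$. **Meshes.** $\mathscr T_\varepsilon^\#$ is the triangulation of $\mathbb R^2$ into closed triangles with vertex set $\mathscr L^\#$ obtained by $\varepsilon\mathbb Z^2$-translation of a splitting of $\varepsilon(0,1)^2$ into two triangles along a diagonal; $\mathscr T_\varepsilon$ is its restriction to $\Omega$ (triangles contained in $\overline\Omega$). Each $v:\mathscr L^\#\to\mathbb R^k$ is identified with its continuous piecewise affine interpolant on $\mathscr T_\varepsilon^\#$. $\mathscr T_h$ is a regular triangulation of $\overline\Omega$ (closed triangles, vertices in $\mathscr L^\#$) extending $2\mathbb Z^2$-periodically to a regular triangulation $\mathscr T_h^\#$ of $\mathbb R^2$; $\mathscr U_h$ is the space of $u_h\in\mathscr U$ that are restrictions of continuous functions piecewise affine with respect to $\mathscr T_h^\#$, with which they are identified. **a/c energy.** $\mathscr T_h$ is the disjoint union of $\mathscr T_h^{\rm a},\mathscr T_h^{\rm i},\mathscr T_h^{\rm c}$, with (closed) unions $\Omega_{\rm a},\Omega_{\rm i},\Omega_{\rm c}$; $\mathscr T_\varepsilon^{\rm a},\mathscr T_\varepsilon^{\rm i},\mathscr T_\varepsilon^{\rm c}$ are the sets of $T\in\mathscr T_\varepsilon$ contained in $\Omega_{\rm a},\Omega_{\rm i},\Omega_{\rm c}$. Bonds $(x,x')$ are identified with closed segments. $\mathscr L_{\rm a}=\{x\in\mathscr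 L:(x,x+\varepsilon r)\cap\Omega_{\rm a}^\#\ne\emptyset\text{ for some }r\in\mathscr R\}$; $\mathscr B_{\rm i}=\{(x,x+\varepsilon r):x\in\mathscr L,r\in\mathscr R,(x,x+\varepsilon r)\subset\Omega_{\rm i}^\#\}$, and $\mathscr B_{\rm i}^\#$ is the set of all $2\mathbb Z^2$-translates of bonds in $\mathscr B_{\rm i}$. $\mathscr E_{\rm i}(y)=\varepsilon^2E_{\rm i}((D_ry(x))_{(x,x+\varepsilon r)\in\mathscr B_{\rm i}})$ with $E_{\rm i}\in C^2$; $\partial_bE_{\rm i}(y)\in\mathbb R^2$ is its partial derivative with respect to the variable of bond $b$, evaluated at the finite differences of $y$, extended by $\partial_{\xi+b}E_{\rm i}=\partial_bE_{\rm i}$ for $\xi\in2\mathbb Z^2$. For $\tilde y\in\mathscr Y+\mathscr U_h$ (elements of $\mathscr Y$ interpolated on $\mathscr T_\varepsilon^\#$, of $\mathscr U_h$ on $\mathscr T_h^\#$), $\mathscr E_{\rm ac}(\tilde y)=\int_{\Omega_{\rm c}}W(\nabla\tilde y)\,dx+\varepsilon^2\sum_{x\in\mathscr L_{\rm a}}V(D_{\mathscr R}\tilde y(x))+\mathscr E_{\rm i}(\tilde y)$. Standing assumptions: $\mathscr T_h^{\rm a}\cup\mathscr T_h^{\rm i}\subset\mathscr T_\varepsilon$, and $\{x+t\varepsilon r:x\in\mathscr L_{\rm a},t\in[0,1],r\in\mathscr R\}\subset\Omega_{\rm a}\cup\Omega_{\rm i}$. **Stress functions.** For a triangle $T$, $\chi_T(x)=\lim_{t\searrow0}|T\cap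 B_t(x)|/|B_t(x)|$; bond integral $⨍$: write $\langle\varphi\rangle_{x,x'}=\int_0^1\varphi((1-t)x+tx')\,dt$. For $T\in\mathscr T_\varepsilon^{\rm i}$ let $\chi_T^{\rm i}(x)=1$ if $x\in T\cap\partial\Omega_{\rm i}^\#$ and $\chi_T^{\rm i}(x)=\chi_T(x)$ otherwise. The piecewise constant function $\Sigma_{\rm ac}(y)$ has the following value $\Sigma_{\rm ac}(y;T)\in\mathbb R^{2\times 2}$ on $T\in\mathscr T_\varepsilon$: for $T\in\mathscr T_\varepsilon^{\rm a}$, $\Sigma_{\rm ac}(y;T)=\sum_{r\in\mathscr R}\frac{\varepsilon^2}{|T|}\sum_{x\in\mathscr L^\#}[\partial_rV(D_{\mathscr R}y(x))\otimes r]\langle\chi_T\rangle_{x,x+\varepsilon r}$; for $T\in\mathscr T_\varepsilon^{\rm c}$, $\Sigma_{\rm ac}(y;T)=\partial W(\nabla y(T))$; for $T\in\mathscr T_\varepsilon^{\rm i}$, $$\Sigma_{\rm ac}(y;T)=\sum_{r\in\mathscr R}\frac{\varepsilon^2}{|T|}\sum_{x\in\mathscr L_{\rm a}^\#}[\partial_rV(D_{\mathscr R}y(x))\otimes r]\langle\chi_T\rangle_{x,x+\varepsilon r}+\frac{\varepsilon^2}{|T|}\sum_{(x,x+\varepsilon r)\in\mathscr B_{\rm i}^\#}[\partial_{(x,x+\varepsilon r)}E_{\rm i}(y)\otimes r]\langle\chi_T^{\rm i}\rangle_{x,x+\varepsilon r}.$$ Here $(a\otimes r)_{ij}=a_ir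_j$.
   Formalization: Added assumption: for x in L_a, r in R, the bond (x,x+εr) meets the boundary of Ω_a∪Ω_i in only finitely many points; otherwise χ_T gives half the weight of a bond along that boundary to continuum triangles, where Σ_ac=∂W ignores it, and the claim fails. *)

theory Defs
  imports "HOL-Analysis.Analysis"
begin

type_synonym vec2 = "real^2"
type_synonym mat2 = "real^2^2"

section \<open>Differentiation with respect to blocks of variables\<close>

text \<open>A function of finitely many vector variables, indexed by a finite set I, is represented by a
  function on all families indexed by a type, depending only on the members with index in I.  This
  also covers empty I.  Continuity of such a function refers to the product topology.\<close>

definition depends_on :: "'i set \<Rightarrow> (('i \<Rightarrow> vec2) \<Rightarrow> real) \<Rightarrow> bool" where
  "depends_on I f \<longleftrightarrow> (\<forall>g g'. (\<forall>i\<in>I. g i = g' i) \<longrightarrow> f g = f g')"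

definition grad :: "('a::real_inner \<Rightarrow> real) \<Rightarrow> 'a \<Rightarrow> 'a" where
  "grad f x = (THE D. GDERIV f x :> D)"

definition pgrad :: "'i \<Rightarrow> (('i \<Rightarrow> vec2) \<Rightarrow> real) \<Rightarrow> ('i \<Rightarrow> vec2) \<Rightarrow> vec2" where
  "pgrad i f g = grad (\<lambda>v. f (g(i := v))) (g i)"

definition C1_fun :: "'i set \<Rightarrow> (('i \<Rightarrow> vec2) \<Rightarrow> real) \<Rightarrow> bool" where
  "C1_fun I f \<longleftrightarrow> depends_on I f \<and>
     (\<forall>i\<in>I. (\<forall>g. \<exists>D. GDERIV (\<lambda>v. f (g(i := v))) (g i) :> D) \<and> continuous_on UNIV (pgrad i f))"

definition C2_fun :: "'i set \<Rightarrow> (('i \<Rightarrow> vec2) \<Rightarrow> real) \<Rightarrow> bool" where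
  "C2_fun I f \<longleftrightarrow> C1_fun I f \<and> (\<forall>i\<in>I. \<forall>k. C1_fun I (\<lambda>g. pgrad i f g $ k))"

definition bounded_second_partials :: "'i set \<Rightarrow> (('i \<Rightarrow> vec2) \<Rightarrow> real) \<Rightarrow> bool" where
  "bounded_second_partials I f \<longleftrightarrow>
     (\<exists>C. \<forall>i\<in>I. \<forall>j\<in>I. \<forall>k g. norm (pgrad j (\<lambda>g'. pgrad i f g' $ k) g) \<le> C)"

section \<open>Lattice and periodicity\<close>

definition eps :: "nat \<Rightarrow> real" where
  "eps N = 1 / real N"

definition Z2 :: "vec2 set" where
  "Z2 = {z. \<forall>i. z $ i \<in> \<int>}"

definition Omega :: "vec2 set" where
  "Omega = {x. \<forall>i. -1 < x $ i \<and> x $ i \<le> 1}"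

definition Lat :: "nat \<Rightarrow> vec2 set" where
  "Lat N = {x. \<forall>i. \<exists>k::int. - int N + 1 \<le> k \<and> k \<le> int N \<and> x $ i = eps N * real_of_int k}"

definition Lat_per :: "nat \<Rightarrow> vec2 set" where
  "Lat_per N = (\<lambda>z. eps N *\<^sub>R z) ` Z2"

definition periods :: "vec2 set" where
  "periods = (\<lambda>z. 2 *\<^sub>R z) ` Z2"

definition per :: "vec2 set \<Rightarrow> vec2 set" where
  "per A = (\<Union>\<xi>\<in>periods. (\<lambda>x. \<xi> + x) ` A)"

definition FD :: "nat \<Rightarrow> vec2 \<Rightarrow> (vec2 \<Rightarrow> vec2) \<Rightarrow> vec2 \<Rightarrow> vec2" where
  "FD N r v x = (v (x + eps N *\<^sub>R r) - v x) /\<^sub>R eps N"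

text \<open>The family D_R y(x); the members with index outside the interaction range are irrelevant,
  since the site potential does not depend on them.\<close>

definition stencil :: "nat \<Rightarrow> (vec2 \<Rightarrow> vec2) \<Rightarrow> vec2 \<Rightarrow> (vec2 \<Rightarrow> vec2)" where
  "stencil N y x = (\<lambda>r. FD N r y x)"

definition W :: "((vec2 \<Rightarrow> vec2) \<Rightarrow> real) \<Rightarrow> mat2 \<Rightarrow> real" where
  "W V F = V (\<lambda>r. F *v r)"

text \<open>The inner product of the library on real^2^2 is the Frobenius product, hence this gradient
  is the matrix of the partial derivatives with respect to the entries.\<close>

definition dW :: "((vec2 \<Rightarrow> vec2) \<Rightarrow> real) \<Rightarrow> mat2 \<Rightarrow> mat2" where
  "dW V F = grad (W V) F"

definition yhom :: "mat2 \<Rightarrow> vec2 \<Rightarrow> vec2" where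
  "yhom A = (\<lambda>x. A *v x)"

section \<open>Meshes\<close>

text \<open>The two possible splittings of the closed unit square along a diagonal.\<close>

definition unit_split :: "bool \<Rightarrow> vec2 set set" where
  "unit_split d =
     (if d then {convex hull {vector [0,0], vector [1,0], vector [1,1]},
                 convex hull {vector [0,0], vector [0,1], vector [1,1]}}
      else {convex hull {vector [0,0], vector [1,0], vector [0,1]},
            convex hull {vector [1,0], vector [0,1], vector [1,1]}})"

definition Teps_per :: "nat \<Rightarrow> bool \<Rightarrow> vec2 set set" where
  "Teps_per N d = {(\<lambda>x. eps N *\<^sub>R (z + x)) ` T |z T. z \<in> Z2 \<and> T \<in> unit_split d}"

definition Teps :: "nat \<Rightarrow> bool \<Rightarrow> vec2 set set" where
  "Teps N d = {T \<in> Teps_per N d. T \<subseteq> closure Omega}"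

text \<open>Regular means that any two triangles meet in a common (possibly empty) face.  The triangulation
  predicate of the library is not used because it forces finiteness and allows lower-dimensional
  simplices.\<close>

definition regular_triangulation :: "vec2 set set \<Rightarrow> vec2 set \<Rightarrow> bool" where
  "regular_triangulation \<T> S \<longleftrightarrow> (\<forall>T\<in>\<T>. 2 simplex T) \<and> \<Union>\<T> = S \<and>
     (\<forall>T\<in>\<T>. \<forall>T'\<in>\<T>. (T \<inter> T') face_of T \<and> (T \<inter> T') face_of T')"

definition mesh_per :: "vec2 set set \<Rightarrow> vec2 set set" where
  "mesh_per \<T> = {(\<lambda>x. \<xi> + x) ` T |\<xi> T. \<xi> \<in> periods \<and> T \<in> \<T>}"

definition coarse_mesh :: "nat \<Rightarrow> vec2 set set \<Rightarrow> bool" where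
  "coarse_mesh N Th \<longleftrightarrow> finite Th \<and> regular_triangulation Th (closure Omega) \<and>
     (\<forall>T\<in>Th. \<forall>v. v extreme_point_of T \<longrightarrow> v \<in> Lat_per N) \<and>
     regular_triangulation (mesh_per Th) UNIV"

text \<open>Elements of this space are the interpolants on all of the plane; they are determined by
  their lattice values because all vertices of the mesh are lattice points.\<close>

definition Uh :: "nat \<Rightarrow> vec2 set set \<Rightarrow> (vec2 \<Rightarrow> vec2) set" where
  "Uh N Th = {u. continuous_on UNIV u \<and>
     (\<forall>T\<in>mesh_per Th. \<exists>A b. \<forall>x\<in>T. u x = A *v x + b) \<and>
     (\<forall>x\<in>Lat_per N. \<forall>\<xi>\<in>periods. u (\<xi> + x) = u x)}"

section \<open>The atomistic-to-continuum energy\<close>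

definition sites_a :: "nat \<Rightarrow> vec2 set \<Rightarrow> vec2 set set \<Rightarrow> vec2 set" where
  "sites_a N R Ta =
     {x \<in> Lat N. \<exists>r\<in>R. closed_segment x (x + eps N *\<^sub>R r) \<inter> per (\<Union>Ta) \<noteq> {}}"

text \<open>The pair (x, r) encodes the bond (x, x + eps r).\<close>

definition bonds_i :: "nat \<Rightarrow> vec2 set \<Rightarrow> vec2 set set \<Rightarrow> (vec2 \<times> vec2) set" where
  "bonds_i N R Ti =
     {(x, r). x \<in> Lat N \<and> r \<in> R \<and> closed_segment x (x + eps N *\<^sub>R r) \<subseteq> per (\<Union>Ti)}"

definition bonds_i_per :: "nat \<Rightarrow> vec2 set \<Rightarrow> vec2 set set \<Rightarrow> (vec2 \<times> vec2) set" where
  "bonds_i_per N R Ti = {(\<xi> + x, r) |\<xi> x r. \<xi> \<in> periods \<and> (x, r) \<in> bonds_i N R Ti}"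

definition bond_diffs :: "nat \<Rightarrow> (vec2 \<Rightarrow> vec2) \<Rightarrow> (vec2 \<times> vec2) \<Rightarrow> vec2" where
  "bond_diffs N y = (\<lambda>(x, r). FD N r y x)"

definition jacobian :: "(vec2 \<Rightarrow> vec2) \<Rightarrow> vec2 \<Rightarrow> mat2" where
  "jacobian y x = matrix (frechet_derivative y (at x))"

text \<open>The argument y is a function on the plane: the sum of the fine-mesh interpolant of a
  deformation and of an element of Uh.  The deformation yhom A is its own interpolant.\<close>

definition E_ac :: "nat \<Rightarrow> vec2 set \<Rightarrow> ((vec2 \<Rightarrow> vec2) \<Rightarrow> real) \<Rightarrow> ((vec2 \<times> vec2 \<Rightarrow> vec2) \<Rightarrow> real)
    \<Rightarrow> vec2 set set \<Rightarrow> vec2 set set \<Rightarrow> (vec2 \<Rightarrow> vec2) \<Rightarrow> real" where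
  "E_ac N R V Ei Ta Tc y =
     integral (\<Union>Tc) (\<lambda>x. W V (jacobian y x))
     + (eps N)\<^sup>2 * (\<Sum>x\<in>sites_a N R Ta. V (stencil N y x))
     + (eps N)\<^sup>2 * Ei (bond_diffs N y)"

definition first_variation :: "((vec2 \<Rightarrow> vec2) \<Rightarrow> real) \<Rightarrow> (vec2 \<Rightarrow> vec2) \<Rightarrow> (vec2 \<Rightarrow> vec2) \<Rightarrow> real" where
  "first_variation E y z = deriv (\<lambda>t::real. E (\<lambda>x. y x + t *\<^sub>R z x)) 0"

definition patch_test_consistent ::
  "nat \<Rightarrow> vec2 set set \<Rightarrow> ((vec2 \<Rightarrow> vec2) \<Rightarrow> real) \<Rightarrow> bool" where
  "patch_test_consistent N Th E \<longleftrightarrow> (\<forall>F. \<forall>u\<in>Uh N Th. first_variation E (yhom F) u = 0)"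

section \<open>The stress function\<close>

definition tensor :: "vec2 \<Rightarrow> vec2 \<Rightarrow> mat2" where
  "tensor a r = (\<chi> i j. a $ i * r $ j)"

definition area :: "vec2 set \<Rightarrow> real" where
  "area A = measure lebesgue A"

definition chi :: "vec2 set \<Rightarrow> vec2 \<Rightarrow> real" where
  "chi T x = Lim (at_right 0) (\<lambda>t. area (T \<inter> ball x t) / area (ball x t))"

definition chi_i :: "vec2 set set \<Rightarrow> vec2 set \<Rightarrow> vec2 \<Rightarrow> real" where
  "chi_i Ti T x = (if x \<in> T \<inter> frontier (per (\<Union>Ti)) then 1 else chi T x)"

definition bond_avg :: "(vec2 \<Rightarrow> real) \<Rightarrow> vec2 \<Rightarrow> vec2 \<Rightarrow> real" where
  "bond_avg \<phi> x x' = integral {0..1} (\<lambda>t. \<phi> ((1 - t) *\<^sub>R x + t *\<^sub>R x'))"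

text \<open>Periodic extension of the partial derivatives of the interface energy: every lattice point
  has exactly one periodic representative in Lat N.\<close>

definition dEi :: "nat \<Rightarrow> ((vec2 \<times> vec2 \<Rightarrow> vec2) \<Rightarrow> real) \<Rightarrow> (vec2 \<Rightarrow> vec2) \<Rightarrow> vec2 \<times> vec2 \<Rightarrow> vec2" where
  "dEi N Ei y = (\<lambda>(x, r). pgrad (THE x0. x0 \<in> Lat N \<and> x - x0 \<in> periods, r) Ei (bond_diffs N y))"

definition grad_on :: "(vec2 \<Rightarrow> vec2) \<Rightarrow> vec2 set \<Rightarrow> mat2" where
  "grad_on y T = (THE A. \<exists>b. \<forall>x\<in>T. y x = A *v x + b)"

text \<open>The infinite sums have only finitely many nonzero terms.  As in the energy, y stands for its
  fine-mesh interpolant.\<close>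

definition stress_on :: "nat \<Rightarrow> vec2 set \<Rightarrow> ((vec2 \<Rightarrow> vec2) \<Rightarrow> real)
    \<Rightarrow> ((vec2 \<times> vec2 \<Rightarrow> vec2) \<Rightarrow> real) \<Rightarrow> vec2 set set \<Rightarrow> vec2 set set \<Rightarrow> vec2 set set
    \<Rightarrow> (vec2 \<Rightarrow> vec2) \<Rightarrow> vec2 set \<Rightarrow> mat2" where
  "stress_on N R V Ei Ta Ti Tc y T =
     (if T \<subseteq> \<Union>Ta then
        (\<Sum>r\<in>R. ((eps N)\<^sup>2 / area T) *\<^sub>R (\<Sum>\<^sub>\<infinity>x\<in>Lat_per N.
           bond_avg (chi T) x (x + eps N *\<^sub>R r) *\<^sub>R tensor (pgrad r V (stencil N y x)) r))
      else if T \<subseteq> \<Union>Tc then dW V (grad_on y T)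
      else if T \<subseteq> \<Union>Ti then
        (\<Sum>r\<in>R. ((eps N)\<^sup>2 / area T) *\<^sub>R (\<Sum>\<^sub>\<infinity>x\<in>per (sites_a N R Ta).
           bond_avg (chi T) x (x + eps N *\<^sub>R r) *\<^sub>R tensor (pgrad r V (stencil N y x)) r))
        + ((eps N)\<^sup>2 / area T) *\<^sub>R (\<Sum>\<^sub>\<infinity>(x, r)\<in>bonds_i_per N R Ti.
           bond_avg (chi_i Ti T) x (x + eps N *\<^sub>R r) *\<^sub>R tensor (dEi N Ei y (x, r)) r)
      else 0)"

text \<open>The piecewise constant stress; its values on the (null) union of the edges are immaterial.\<close>

definition stress :: "nat \<Rightarrow> bool \<Rightarrow> vec2 set \<Rightarrow> ((vec2 \<Rightarrow> vec2) \<Rightarrow> real)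
    \<Rightarrow> ((vec2 \<times> vec2 \<Rightarrow> vec2) \<Rightarrow> real) \<Rightarrow> vec2 set set \<Rightarrow> vec2 set set \<Rightarrow> vec2 set set
    \<Rightarrow> (vec2 \<Rightarrow> vec2) \<Rightarrow> vec2 \<Rightarrow> mat2" where
  "stress N d R V Ei Ta Ti Tc y x =
     (if \<exists>T\<in>Teps N d. x \<in> interior T
      then stress_on N R V Ei Ta Ti Tc y (THE T. T \<in> Teps N d \<and> x \<in> interior T) else 0)"

text \<open>Nondegeneracy: no bond of a site in sites_a runs along the boundary of the union of the atomistic
  and interface regions.  Half of such a bond would be attributed by chi to triangles of the
  continuum region, whose stress ignores it, so that the stress function would lose part of the
  energy.  The requirement that these bonds lie in the closed union does not exclude this; touching
  the boundary at finitely many points is allowed.\<close>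

definition no_bond_along_boundary :: "nat \<Rightarrow> vec2 set \<Rightarrow> vec2 set set \<Rightarrow> vec2 set set \<Rightarrow> bool" where
  "no_bond_along_boundary N R Ta Ti \<longleftrightarrow> (\<forall>x\<in>sites_a N R Ta. \<forall>r\<in>R.
     finite (closed_segment x (x + eps N *\<^sub>R r) \<inter> frontier (\<Union>Ta \<union> \<Union>Ti)))"

end

theory Submission
  imports Defs
begin

text \<open>
The stress function distributes the derivatives of the discrete energies over the fine triangles.  At a
homogeneous deformation the claim is a balance between the stress \<open>P = dW V F\<close> of the continuum
region and the total stress of the discrete regions, and the patch test delivers exactly this balance
when it is applied to a suitable displacement.

Fix a matrix G.  Since the atomistic and interface regions lie in the open cell, there is a finite
element displacement that equals G x on both and vanishes on the boundary of the cell: interpolate the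
nodal values G v at inner vertices and 0 at boundary vertices (\<open>cut_off_linear_field\<close>).  Its
periodic extension is an admissible test function.  The discrete energies involve only bonds inside
the two regions, so their first variation is the pairing of G with the sum over all bonds of
(bond force) \<open>\<otimes>\<close> (bond direction).  The continuum energy contributes the pairing of P with the
integral of the gradient over the continuum region.  The mean gradient of a field that vanishes on the
boundary is zero (\<open>piecewise_affine_mean_gradient_0\<close>), hence that integral is minus the area of the
discrete regions times G.  As G is arbitrary, the total bond stress equals P times the area of the
discrete regions (\<open>patch_test_balance\<close>).

It remains to see that the integral of the stress function over the discrete regions is the total bond
stress (\<open>total_inner_stress\<close>), that is, that the weights with which a bond enters the triangles add
up to one.  For the densities \<open>chi T\<close> this holds because
non-overlapping triangles share out small discs around every inner point of their union
(\<open>sum_chi_eq_1\<close>).  For the modified weights \<open>chi_i\<close> it also holds along the boundary of the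
interface region, because there a point other than a vertex belongs to a single triangle
(\<open>two_triangles_surround\<close>).  Periodic copies of the bonds do not reach the triangles of the cell.

Two analytic facts are supplied along the way.  Continuous block derivatives give the chain rule for
the energies (\<open>C1_fun_has_derivative\<close>), and the limit in the definition of \<open>chi T\<close> exists for convex T
because shrinking T towards one of its points maps T into itself (\<open>density_ratio_antimono\<close>).
\<close>

section \<open>Functions with continuous block derivatives\<close>

lemma grad_eqI: "GDERIV f x :> D \<Longrightarrow> grad f x = D"
  unfolding grad_def
proof (rule the_equality)
  fix D' assume "GDERIV f x :> D" "GDERIV f x :> D'"
  hence "(\<lambda>h. h \<bullet> D) = (\<lambda>h. h \<bullet> D')"
    unfolding gderiv_def by (rule has_derivative_unique)
  hence "(D' - D) \<bullet> D = (D' - D) \<bullet> D'" by metis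
  hence "(D' - D) \<bullet> (D' - D) = 0" by (simp add: inner_diff_right)
  thus "D' = D" by simp
qed

lemma C1_fun_block_derivative:
  assumes "C1_fun I f" "i \<in> I"
  shows "((\<lambda>v. f (g(i := v))) has_derivative (\<lambda>h. h \<bullet> pgrad i f (g(i := w)))) (at w)"
proof -
  from assms obtain D where "GDERIV (\<lambda>v. f ((g(i := w))(i := v))) ((g(i := w)) i) :> D"
    unfolding C1_fun_def by blast
  moreover from this have "pgrad i f (g(i := w)) = D"
    unfolding pgrad_def by (rule grad_eqI)
  ultimately show ?thesis by (simp add: gderiv_def)
qed

text \<open>Only the block derivatives are given, so that total differentiability along an affine family
  has to be produced from their joint continuity.  The blocks are released one at a time: each
  induction step is the two-variable statement that a function with one differentiable slice and
  one continuous partial derivative is differentiable.\<close>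

lemma C1_fun_has_derivative_blocks:
  fixes L :: "'i \<Rightarrow> 'e::real_normed_vector \<Rightarrow> vec2"
  assumes C1: "C1_fun I f" and L: "\<And>i. bounded_linear (L i)"
    and "finite J" "J \<subseteq> I"
  shows "((\<lambda>x. f (\<lambda>i. if i \<in> J then g i + L i x else g i)) has_derivative
           (\<lambda>h. \<Sum>i\<in>J. L i h \<bullet> pgrad i f g)) (at 0)"
  using assms(3,4)
proof (induction J)
  case empty
  show ?case by simp
next
  case (insert j J)
  define P where "P = (\<lambda>(x::'e) i. if i \<in> J then g i + L i x else g i)"
  have P0: "P 0 = g"
    using L by (auto simp: P_def linear_simps)
  have jJ: "j \<notin> J" and jI: "j \<in> I" using insert by auto
  have contL: "continuous_on UNIV (L i)" for i
    using L by (rule linear_continuous_on)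
  have Pj: "P x j = g j" for x
    using jJ by (simp add: P_def)
  have fx: "((\<lambda>x. f ((P x)(j := g j))) has_derivative (\<lambda>h. \<Sum>i\<in>J. L i h \<bullet> pgrad i f g)) (at 0 within UNIV)"
    using insert.IH insert.prems Pj by (simp add: P_def fun_upd_idem)
  have fy: "((\<lambda>v. f ((P x)(j := v))) has_derivative
              blinfun_apply (blinfun_inner_left (pgrad j f ((P x)(j := v))))) (at v within UNIV)" for x v
    using C1_fun_block_derivative[OF C1 jI, of "P x" v]
    by (simp add: blinfun_inner_left.rep_eq)
  have cP: "continuous_on UNIV (\<lambda>(x, v). (P x)(j := v))"
  proof (rule continuous_on_coordinatewise_then_product)
    fix i
    show "continuous_on UNIV (\<lambda>q. (case q of (x, v) \<Rightarrow> (P x)(j := v)) i)"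
    proof (cases "i = j")
      case True
      have "(\<lambda>q. (case q of (x, v) \<Rightarrow> (P x)(j := v)) i) = snd"
        using True by (auto simp: fun_eq_iff)
      moreover have "continuous_on UNIV (snd :: 'e \<times> vec2 \<Rightarrow> vec2)"
        by (intro continuous_intros)
      ultimately show ?thesis by (simp only:)
    next
      case False
      have "(\<lambda>q. (case q of (x, v) \<Rightarrow> (P x)(j := v)) i) = (\<lambda>q. if i \<in> J then g i + L i (fst q) else g i)"
        using False by (auto simp: fun_eq_iff P_def)
      moreover have "continuous_on UNIV (\<lambda>q::'e \<times> vec2. L i (fst q))"
        by (rule continuous_on_compose2[OF contL]) (auto intro: continuous_intros)
      ultimately show ?thesis by (cases "i \<in> J") (simp_all only: if_True if_False,
          intro continuous_intros, simp_all)
    qed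
  qed
  have "continuous_on UNIV (pgrad j f)"
    using C1 jI by (auto simp: C1_fun_def)
  hence cpg: "continuous_on UNIV (\<lambda>q. pgrad j f (case q of (x, v) \<Rightarrow> (P x)(j := v)))"
    using continuous_on_compose2[OF _ cP] by blast
  have "continuous_on UNIV (\<lambda>q. blinfun_inner_left (pgrad j f (case q of (x, v) \<Rightarrow> (P x)(j := v))))"
    by (rule bounded_linear.continuous_on[OF bounded_linear_blinfun_inner_left cpg])
  hence fy_cont: "continuous (at (0, g j) within UNIV \<times> UNIV)
          (\<lambda>(x, v). blinfun_inner_left (pgrad j f ((P x)(j := v))))"
    by (simp add: continuous_on_eq_continuous_within case_prod_unfold)
  have D2: "((\<lambda>(x, v). f ((P x)(j := v))) has_derivative
       (\<lambda>(tx, tv). (\<Sum>i\<in>J. L i tx \<bullet> pgrad i f g) + blinfun_inner_left (pgrad j f ((P 0)(j := g j))) tv))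
       (at (0, g j) within UNIV \<times> UNIV)"
    by (rule has_derivative_partialsI[OF fx fy fy_cont]) auto
  have Dc: "((\<lambda>x. (x, g j + L j x)) has_derivative (\<lambda>h. (h, L j h))) (at 0)"
    using L by (auto intro!: derivative_eq_intros bounded_linear_imp_has_derivative)
  have "L j 0 = 0" using L by (simp add: linear_simps)
  hence D2': "((\<lambda>(x, v). f ((P x)(j := v))) has_derivative
       (\<lambda>(tx, tv). (\<Sum>i\<in>J. L i tx \<bullet> pgrad i f g) + blinfun_inner_left (pgrad j f ((P 0)(j := g j))) tv))
       (at (0, g j + L j 0))"
    using D2 by simp
  have "((\<lambda>x. f ((P x)(j := g j + L j x))) has_derivative
       (\<lambda>h. (\<Sum>i\<in>J. L i h \<bullet> pgrad i f g) + blinfun_inner_left (pgrad j f ((P 0)(j := g j))) (L j h)))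
       (at 0)"
    using has_derivative_compose[OF Dc D2'] by simp
  moreover have "(P x)(j := g j + L j x) = (\<lambda>i. if i \<in> insert j J then g i + L i x else g i)" for x
    using jJ by (auto simp: P_def fun_eq_iff)
  ultimately show ?case
    using insert.hyps P0
    by (simp add: blinfun_inner_left.rep_eq add.commute)
qed

lemma C1_fun_has_derivative:
  fixes L :: "'i \<Rightarrow> 'e::real_normed_vector \<Rightarrow> vec2"
  assumes "C1_fun I f" "finite I" "\<And>i. bounded_linear (L i)"
  shows "((\<lambda>x. f (\<lambda>i. g i + L i x)) has_derivative (\<lambda>h. \<Sum>i\<in>I. L i h \<bullet> pgrad i f g)) (at 0)"
proof -
  have "f (\<lambda>i. g i + L i x) = f (\<lambda>i. if i \<in> I then g i + L i x else g i)" for x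
    using assms(1) by (auto simp: C1_fun_def depends_on_def)
  thus ?thesis
    using C1_fun_has_derivative_blocks[OF assms(1,3,2) order.refl, of g] by simp
qed

lemma C1_fun_line_derivative:
  assumes "C1_fun I f" "finite I" "\<And>i. i \<in> I \<Longrightarrow> h i = k i"
  shows "((\<lambda>t. f (\<lambda>i. g i + t *\<^sub>R h i)) has_real_derivative (\<Sum>i\<in>I. k i \<bullet> pgrad i f g)) (at 0)"
proof -
  have "((\<lambda>t. f (\<lambda>i. g i + t *\<^sub>R h i)) has_derivative (\<lambda>s. \<Sum>i\<in>I. (s *\<^sub>R h i) \<bullet> pgrad i f g)) (at 0)"
    by (rule C1_fun_has_derivative[OF assms(1,2)]) (rule bounded_linear_scaleR_left)
  moreover have "(\<lambda>s. \<Sum>i\<in>I. (s *\<^sub>R h i) \<bullet> pgrad i f g) = (*) (\<Sum>i\<in>I. k i \<bullet> pgrad i f g)"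
    using assms(3) by (auto simp: fun_eq_iff sum_distrib_left mult.commute intro!: sum.cong)
  ultimately show ?thesis by (simp add: has_field_derivative_def)
qed

text \<open>The pairing with the Frobenius product is what turns derivatives of the energy into stresses.\<close>

lemma inner_tensor: "G \<bullet> tensor a r = (G *v r) \<bullet> a"
  by (simp add: inner_vec_def tensor_def matrix_vector_mult_def sum_distrib_left sum_distrib_right
      UNIV_2 algebra_simps)

lemma bounded_linear_matrix_apply: "bounded_linear (\<lambda>G::mat2. G *v r)"
  by (rule linear_conv_bounded_linear[THEN iffD1], rule linearI)
     (simp_all add: matrix_vector_mult_add_rdistrib scaleR_matrix_vector_assoc)

lemma W_gradient:
  assumes "C1_fun R V" "finite R"
  shows "GDERIV (W V) F :> (\<Sum>r\<in>R. tensor (pgrad r V (\<lambda>r. F *v r)) r)"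
proof -
  let ?P = "\<Sum>r\<in>R. tensor (pgrad r V (\<lambda>r. F *v r)) r"
  have "((\<lambda>G. V (\<lambda>r. F *v r + G *v r)) has_derivative (\<lambda>G. G \<bullet> ?P)) (at 0)"
    using C1_fun_has_derivative[OF assms, of "\<lambda>r G. G *v r" "\<lambda>r. F *v r"] bounded_linear_matrix_apply
    by (simp add: inner_sum_right inner_tensor)
  hence *: "((\<lambda>G. W V (F + G)) has_derivative (\<lambda>G. G \<bullet> ?P)) (at 0)"
    by (simp add: W_def matrix_vector_mult_add_rdistrib)
  have "((\<lambda>G. G - F) has_derivative (\<lambda>G. G)) (at F)"
    by (auto intro!: derivative_eq_intros)
  from has_derivative_compose[OF this, of "\<lambda>G. W V (F + G)"] * show ?thesis
    by (simp add: gderiv_def)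
qed

lemma dW_eq:
  assumes "C1_fun R V" "finite R"
  shows "dW V F = (\<Sum>r\<in>R. tensor (pgrad r V (\<lambda>r. F *v r)) r)"
  unfolding dW_def by (rule grad_eqI[OF W_gradient[OF assms]])

lemma W_line_derivative:
  assumes "C1_fun R V" "finite R"
  shows "((\<lambda>t. W V (F + t *\<^sub>R G)) has_real_derivative (G \<bullet> dW V F)) (at 0)"
proof -
  have "((\<lambda>G. W V G) has_derivative (\<lambda>G. G \<bullet> dW V F)) (at (F + 0 *\<^sub>R G))"
    using W_gradient[OF assms, of F] by (simp add: dW_eq[OF assms] gderiv_def)
  moreover have "((\<lambda>t. F + t *\<^sub>R G) has_derivative (\<lambda>t. t *\<^sub>R G)) (at 0)"
    by (auto intro!: derivative_eq_intros)
  ultimately have "((\<lambda>t. W V (F + t *\<^sub>R G)) has_derivative (\<lambda>t. (t *\<^sub>R G) \<bullet> dW V F)) (at 0)"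
    using has_derivative_compose[of "\<lambda>t. F + t *\<^sub>R G" "\<lambda>t. t *\<^sub>R G" 0 UNIV "W V" "\<lambda>G. G \<bullet> dW V F"] by simp
  thus ?thesis
    by (simp add: has_field_derivative_def mult_commute_abs)
qed

section \<open>Densities of convex sets\<close>

definition density_ratio :: "vec2 set \<Rightarrow> vec2 \<Rightarrow> real \<Rightarrow> real" where
  "density_ratio S x t = area (S \<inter> ball x t) / area (ball x t)"

lemma area_ball: "t \<ge> 0 \<Longrightarrow> area (ball x t) = unit_ball_vol 2 * t\<^sup>2"
  using content_ball[of t x] by (simp add: area_def)

lemma area_ball_pos: "t > 0 \<Longrightarrow> area (ball x t) > 0"
  by (simp add: area_ball)

lemma convex_Int_ball_lmeasurable:
  fixes S :: "vec2 set"
  assumes "convex S" shows "S \<inter> ball x t \<in> lmeasurable"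
  by (rule measurable_convex) (auto intro: convex_Int assms bounded_subset[OF bounded_ball])

lemma density_ratio_bounds:
  assumes "convex S" "t > 0"
  shows "0 \<le> density_ratio S x t" "density_ratio S x t \<le> 1"
proof -
  show "0 \<le> density_ratio S x t"
    by (simp add: density_ratio_def area_def)
  have "area (S \<inter> ball x t) \<le> area (ball x t)"
    unfolding area_def
    by (rule measure_mono_fmeasurable) (auto intro: fmeasurableD convex_Int_ball_lmeasurable assms)
  thus "density_ratio S x t \<le> 1"
    using area_ball_pos[OF assms(2), of x] by (simp add: density_ratio_def)
qed

text \<open>Shrinking a convex set towards one of its points maps it into itself, so that it fills a
  larger proportion of a smaller disc.\<close>

lemma density_ratio_antimono:
  assumes S: "convex S" "x \<in> S" and st: "0 < s" "s \<le> t"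
  shows "density_ratio S x t \<le> density_ratio S x s"
proof -
  define m where "m = s / t"
  have t: "t > 0" and m: "0 < m" "m \<le> 1" using st by (auto simp: m_def)
  define h where "h = (\<lambda>y. m *\<^sub>R y + (1 - m) *\<^sub>R x)"
  have sub: "h ` (S \<inter> ball x t) \<subseteq> S \<inter> ball x s"
  proof clarify
    fix y assume y: "y \<in> S" "y \<in> ball x t"
    have "h y \<in> S"
      using convexD[OF S(1) y(1) S(2), of m "1 - m"] m by (simp add: h_def)
    moreover have "x - h y = m *\<^sub>R (x - y)"
      by (simp add: h_def algebra_simps)
    hence "dist x (h y) = m * dist x y"
      using m by (simp add: dist_norm)
    hence "dist x (h y) < m * t"
      using y m by simp
    ultimately show "h y \<in> S \<inter> ball x s"
      using t by (simp add: m_def)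
  qed
  have "m\<^sup>2 * area (S \<inter> ball x t) = area (h ` (S \<inter> ball x t))"
    using measure_lebesgue_affine[of m "(1 - m) *\<^sub>R x" "S \<inter> ball x t"]
    by (simp add: area_def h_def)
  also have "\<dots> \<le> area (S \<inter> ball x s)"
    unfolding area_def
  proof (rule measure_mono_fmeasurable[OF sub])
    have "convex (h ` (S \<inter> ball x t))"
      using convex_affinity[OF convex_Int[OF S(1) convex_ball[of x t]], of "(1 - m) *\<^sub>R x" m]
      by (simp add: h_def add.commute)
    moreover have "bounded (h ` (S \<inter> ball x t))"
      by (rule bounded_subset[OF _ sub]) (auto intro: bounded_subset[OF bounded_ball])
    ultimately show "h ` (S \<inter> ball x t) \<in> sets lebesgue"
      by (intro fmeasurableD measurable_convex)
  qed (rule convex_Int_ball_lmeasurable[OF S(1)])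
  finally have le: "m\<^sup>2 * area (S \<inter> ball x t) \<le> area (S \<inter> ball x s)" .
  have "area (ball x s) = m\<^sup>2 * area (ball x t)"
    using st t by (simp add: area_ball m_def power_divide)
  hence "density_ratio S x s = area (S \<inter> ball x s) / (m\<^sup>2 * area (ball x t))"
    by (simp add: density_ratio_def)
  moreover have "density_ratio S x t = (m\<^sup>2 * area (S \<inter> ball x t)) / (m\<^sup>2 * area (ball x t))"
    using m by (simp add: density_ratio_def)
  ultimately show ?thesis
    using divide_right_mono[OF le, of "m\<^sup>2 * area (ball x t)"] area_ball_pos[OF t, of x] by simp
qed

lemma density_ratio_outside:
  assumes "closed S" "x \<notin> S"
  shows "(density_ratio S x \<longlongrightarrow> 0) (at_right 0)"
proof -
  obtain e where e: "e > 0" "ball x e \<subseteq> - S"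
    using assms open_contains_ball[of "- S"] by auto
  have "S \<inter> ball x t = {}" if "t < e" for t
  proof -
    have "ball x t \<subseteq> ball x e" using that by (intro subset_ball) simp
    thus ?thesis using e(2) by blast
  qed
  hence "\<forall>t. 0 < t \<and> t < e \<longrightarrow> density_ratio S x t = 0"
    by (simp add: density_ratio_def area_def)
  hence "eventually (\<lambda>t. density_ratio S x t = 0) (at_right 0)"
    using e(1) eventually_at_right_field by blast
  thus ?thesis by (rule tendsto_eventually)
qed

lemma density_ratio_limit_exists:
  assumes S: "convex S" "closed S"
  shows "\<exists>l. (density_ratio S x \<longlongrightarrow> l) (at_right 0)"
proof (cases "x \<in> S")
  case False
  thus ?thesis using density_ratio_outside[OF S(2)] by blast
next
  case True
  define l where "l = (SUP t\<in>{0<..}. density_ratio S x t)"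
  have bdd: "bdd_above (density_ratio S x ` {0<..})"
    by (rule bdd_aboveI2[of _ _ 1]) (use density_ratio_bounds(2)[OF S(1)] in auto)
  have "(density_ratio S x \<longlongrightarrow> l) (at_right 0)"
  proof (rule increasing_tendsto)
    have "\<forall>t>0. density_ratio S x t \<le> l"
      unfolding l_def using cSUP_upper[OF _ bdd] by auto
    thus "eventually (\<lambda>t. density_ratio S x t \<le> l) (at_right 0)"
      using eventually_at_right_less[of "0::real"] by (auto elim: eventually_mono)
  next
    fix a assume "a < l"
    then obtain t0 where t0: "t0 > 0" "a < density_ratio S x t0"
      unfolding l_def using less_cSUP_iff[OF _ bdd, of a] by auto
    have "\<forall>t. 0 < t \<and> t < t0 \<longrightarrow> a < density_ratio S x t"
      using density_ratio_antimono[OF S(1) True] t0(2) by (meson less_imp_le less_le_trans)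
    thus "eventually (\<lambda>t. a < density_ratio S x t) (at_right 0)"
      using t0(1) eventually_at_right_field by blast
  qed
  thus ?thesis ..
qed

lemma density_ratio_tendsto_chi:
  assumes "convex S" "closed S"
  shows "(density_ratio S x \<longlongrightarrow> chi S x) (at_right 0)"
proof -
  obtain l where "(density_ratio S x \<longlongrightarrow> l) (at_right 0)"
    using density_ratio_limit_exists[OF assms] by blast
  moreover from this have "chi S x = l"
    unfolding chi_def density_ratio_def by (intro tendsto_Lim) auto
  ultimately show ?thesis by simp
qed

lemma chi_bounds:
  assumes "convex S" "closed S"
  shows "\<bar>chi S x\<bar> \<le> 1"
proof -
  have ev: "eventually (\<lambda>t. \<bar>density_ratio S x t\<bar> \<le> 1) (at_right 0)"
    using eventually_at_right_less[of "0::real"]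
    by (rule eventually_mono) (use density_ratio_bounds[OF assms(1)] in auto)
  show ?thesis
    by (rule tendsto_upperbound[OF tendsto_rabs[OF density_ratio_tendsto_chi[OF assms]] ev]) simp
qed

lemma chi_outside:
  assumes "closed S" "x \<notin> S"
  shows "chi S x = 0"
  using density_ratio_outside[OF assms] unfolding chi_def density_ratio_def
  by (intro tendsto_Lim) auto

text \<open>This is where the densities replace the indicator functions: sets overlapping only in null
  sets share out a small disc completely, even around a point common to several of them.\<close>

lemma sum_chi_eq_1:
  assumes fin: "finite \<T>" and T: "\<And>T. T \<in> \<T> \<Longrightarrow> convex T \<and> closed T"
    and neg: "pairwise (\<lambda>S T. negligible (S \<inter> T)) \<T>" and x: "x \<in> interior (\<Union>\<T>)"
  shows "(\<Sum>T\<in>\<T>. chi T x) = 1"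
proof -
  obtain e where e: "e > 0" "ball x e \<subseteq> \<Union>\<T>"
    using x mem_interior by blast
  have one: "(\<Sum>T\<in>\<T>. density_ratio T x t) = 1" if t: "0 < t" "t < e" for t
  proof -
    have "ball x t \<subseteq> ball x e" using t by (intro subset_ball) simp
    hence "ball x t = (\<Union>T\<in>\<T>. T \<inter> ball x t)"
      using e(2) by blast
    hence "area (ball x t) = measure lebesgue (\<Union>T\<in>\<T>. T \<inter> ball x t)"
      by (simp add: area_def)
    also have "\<dots> = (\<Sum>T\<in>\<T>. measure lebesgue (T \<inter> ball x t))"
    proof (rule measure_negligible_finite_Union_image[OF fin])
      show "pairwise (\<lambda>S T. negligible ((S \<inter> ball x t) \<inter> (T \<inter> ball x t))) \<T>"
        using neg unfolding pairwise_def by (meson inf_le1 inf_mono negligible_subset)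
    qed (use T convex_Int_ball_lmeasurable in auto)
    finally show ?thesis
      using area_ball_pos[OF t(1), of x]
      by (simp add: density_ratio_def area_def sum_divide_distrib[symmetric])
  qed
  have "((\<lambda>t. \<Sum>T\<in>\<T>. density_ratio T x t) \<longlongrightarrow> (\<Sum>T\<in>\<T>. chi T x)) (at_right 0)"
    by (rule tendsto_sum) (use T density_ratio_tendsto_chi in blast)
  moreover have "((\<lambda>t. \<Sum>T\<in>\<T>. density_ratio T x t) \<longlongrightarrow> 1) (at_right 0)"
    by (rule tendsto_eventually) (use one e(1) eventually_at_right_field in blast)
  ultimately show ?thesis
    by (rule tendsto_unique[rotated]) simp
qed

text \<open>Each density ratio is, up to a constant, the area of a section of a Borel set of pairs.  Measurability is what
  makes the bond averages of the densities genuine, hence additive, integrals.\<close>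

lemma chi_borel_measurable:
  assumes S: "convex S" "closed S"
  shows "chi S \<in> borel_measurable borel"
proof (rule borel_measurable_LIMSEQ_real)
  fix x
  have "filterlim (\<lambda>n. inverse (real (Suc n))) (at_right 0) sequentially"
    unfolding filterlim_at using LIMSEQ_inverse_real_of_nat by (auto intro!: always_eventually)
  thus "(\<lambda>n. density_ratio S x (inverse (real (Suc n)))) \<longlonglongrightarrow> chi S x"
    by (rule filterlim_compose[OF density_ratio_tendsto_chi[OF S]])
next
  fix n :: nat
  define t where "t = inverse (real (Suc n))"
  have t: "t > 0" by (simp add: t_def)
  define Q where "Q = (UNIV \<times> S) \<inter> {q. dist (fst q) (snd q) < t}"
  have "open {q :: vec2 \<times> vec2. dist (fst q) (snd q) < t}"
    by (intro open_Collect_less continuous_intros)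
  hence "Q \<in> sets (borel :: (vec2 \<times> vec2) measure)"
    unfolding Q_def using S by (intro sets.Int borel_open borel_closed closed_Times) auto
  hence "Q \<in> sets ((borel :: vec2 measure) \<Otimes>\<^sub>M (lborel :: vec2 measure))"
    by (simp add: borel_prod[symmetric] cong: sets_pair_measure_cong)
  hence "(\<lambda>x. emeasure lborel (Pair x -` Q)) \<in> borel_measurable borel"
    by (rule lborel.measurable_emeasure_Pair)
  hence "(\<lambda>x. enn2real (emeasure lborel (Pair x -` Q))) \<in> borel_measurable borel"
    by measurable
  moreover have "enn2real (emeasure lborel (Pair x -` Q)) = area (S \<inter> ball x t)" for x
  proof -
    have "Pair x -` Q = S \<inter> ball x t" by (auto simp: Q_def)
    moreover have "S \<inter> ball x t \<in> sets borel"
      using S by (intro sets.Int) (auto intro: borel_closed)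
    ultimately show ?thesis by (simp add: area_def measure_def)
  qed
  ultimately show "(\<lambda>x. density_ratio S x (inverse (real (Suc n)))) \<in> borel_measurable borel"
    using t unfolding t_def[symmetric] density_ratio_def by (simp add: area_ball)
qed

section \<open>Averages along bonds\<close>

lemma bond_integrable:
  fixes \<phi> :: "vec2 \<Rightarrow> real"
  assumes "\<phi> \<in> borel_measurable borel" "\<And>x. \<bar>\<phi> x\<bar> \<le> 1"
  shows "(\<lambda>t. \<phi> ((1 - t) *\<^sub>R x + t *\<^sub>R x')) integrable_on {0..1::real}"
proof (rule measurable_bounded_by_integrable_imp_integrable)
  have "(\<lambda>t. \<phi> ((1 - t) *\<^sub>R x + t *\<^sub>R x')) \<in> borel_measurable borel"
    by (rule measurable_compose[OF _ assms(1)])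
       (intro borel_measurable_continuous_onI continuous_intros)
  hence "(\<lambda>t. \<phi> ((1 - t) *\<^sub>R x + t *\<^sub>R x')) \<in> borel_measurable lebesgue"
    by (simp add: measurable_completion)
  thus "(\<lambda>t. \<phi> ((1 - t) *\<^sub>R x + t *\<^sub>R x')) \<in> borel_measurable (lebesgue_on {0..1})"
    by (rule measurable_restrict_space1)
  show "(\<lambda>_. 1::real) integrable_on {0..1::real}"
    by (rule integrable_const_ivl)
qed (use assms(2) in auto)

lemma sum_bond_avg_eq_1:
  assumes "finite \<T>" and \<phi>: "\<And>T. T \<in> \<T> \<Longrightarrow> \<phi> T \<in> borel_measurable borel"
    "\<And>T x. T \<in> \<T> \<Longrightarrow> \<bar>\<phi> T x\<bar> \<le> 1"
    and ne: "x \<noteq> x'" and E: "finite (closed_segment x x' \<inter> E)"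
    and one: "\<And>y. y \<in> closed_segment x x' \<Longrightarrow> y \<notin> E \<Longrightarrow> (\<Sum>T\<in>\<T>. \<phi> T y) = 1"
  shows "(\<Sum>T\<in>\<T>. bond_avg (\<phi> T) x x') = 1"
proof -
  define p where "p = (\<lambda>t::real. (1 - t) *\<^sub>R x + t *\<^sub>R x')"
  have "inj_on p {0..1}"
  proof (rule inj_onI)
    fix s t assume "p s = p t"
    moreover have "p s - p t = (s - t) *\<^sub>R (x' - x)" by (simp add: p_def algebra_simps)
    ultimately show "s = t" using ne by simp
  qed
  have seg: "p ` {0..1} = closed_segment x x'"
    by (auto simp: p_def closed_segment_def)
  define B where "B = {t \<in> {0..1}. p t \<in> E}"
  have "p ` B \<subseteq> closed_segment x x' \<inter> E"
    using seg by (auto simp: B_def)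
  hence "finite (p ` B)" using E finite_subset by blast
  moreover have "inj_on p B"
    using \<open>inj_on p {0..1}\<close> by (rule inj_on_subset) (auto simp: B_def)
  ultimately have "finite B" by (rule finite_imageD)
  have "(\<Sum>T\<in>\<T>. bond_avg (\<phi> T) x x') = integral {0..1} (\<lambda>t. \<Sum>T\<in>\<T>. \<phi> T (p t))"
    unfolding bond_avg_def p_def
    by (rule integral_sum[symmetric]) (use assms(1) \<phi> bond_integrable in auto)
  also have "\<dots> = integral {0..1} (\<lambda>t::real. 1::real)"
  proof (rule integral_spike[OF negligible_finite[OF \<open>finite B\<close>]])
    fix t assume t: "t \<in> {0..1} - B"
    hence "p t \<in> closed_segment x x'" "p t \<notin> E"
      using seg by (auto simp: B_def)
    thus "1 = (\<Sum>T\<in>\<T>. \<phi> T (p t))" using one by simp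
  qed
  also have "\<dots> = 1" by simp
  finally show ?thesis .
qed

lemma bond_avg_eq_0:
  assumes "\<And>y. y \<in> closed_segment x x' \<Longrightarrow> \<phi> y = 0"
  shows "bond_avg \<phi> x x' = 0"
proof -
  have "\<phi> ((1 - t) *\<^sub>R x + t *\<^sub>R x') = 0" if "t \<in> {0..1}" for t
    using that by (intro assms) (auto simp: closed_segment_def)
  hence "bond_avg \<phi> x x' = integral {0..1} (\<lambda>t::real. 0::real)"
    unfolding bond_avg_def by (rule integral_cong)
  thus ?thesis by simp
qed

lemma chi_i_bounds:
  assumes "convex T" "closed T"
  shows "\<bar>chi_i Ti T x\<bar> \<le> 1"
  using chi_bounds[OF assms] by (simp add: chi_i_def)

lemma chi_i_borel_measurable:
  assumes "convex T" "closed T"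
  shows "chi_i Ti T \<in> borel_measurable borel"
proof -
  have "T \<inter> frontier (per (\<Union>Ti)) \<in> sets borel"
    using assms by (intro borel_closed closed_Int frontier_closed)
  thus ?thesis
    unfolding chi_i_def[abs_def] using chi_borel_measurable[OF assms]
    by (intro measurable_If_set) auto
qed

lemma chi_i_outside:
  assumes "closed T" "x \<notin> T" shows "chi_i Ti T x = 0"
  using chi_outside[OF assms] assms by (simp add: chi_i_def)

section \<open>Triangles meeting in faces\<close>

lemma triangle_interior_nonempty:
  fixes T :: "vec2 set"
  assumes "2 simplex T" shows "interior T \<noteq> {}"
proof -
  have ad: "aff_dim T = int (DIM(vec2))"
    using aff_dim_simplex[OF assms] by simp
  have "T \<noteq> {}" using ad by auto
  hence "rel_interior T \<noteq> {}"
    using rel_interior_eq_empty[OF convex_simplex[OF assms]] by simp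
  thus ?thesis using interior_rel_interior_gen[of T] ad by simp
qed

lemma convex_subset_closure_interior:
  fixes T :: "vec2 set"
  assumes "convex T" "interior T \<noteq> {}" "interior T \<subseteq> C" "closed C"
  shows "T \<subseteq> C"
proof -
  have "T \<subseteq> closure (interior T)"
    using convex_closure_interior[OF assms(1,2)] closure_subset by simp
  thus ?thesis using closure_minimal[OF assms(3,4)] by blast
qed

context
  fixes \<T> :: "vec2 set set" and S :: "vec2 set"
  assumes reg: "regular_triangulation \<T> S"
begin

lemma triangulation_simplex: "T \<in> \<T> \<Longrightarrow> 2 simplex T"
  using reg by (simp add: regular_triangulation_def)

lemma triangulation_convex: "T \<in> \<T> \<Longrightarrow> convex T"
  using triangulation_simplex convex_simplex by blast

lemma triangulation_compact: "T \<in> \<T> \<Longrightarrow> compact T"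
  using triangulation_simplex compact_simplex by blast

lemma triangulation_closed: "T \<in> \<T> \<Longrightarrow> closed T"
  using triangulation_compact compact_imp_closed by blast

lemma triangulation_lmeasurable: "T \<in> \<T> \<Longrightarrow> T \<in> lmeasurable"
  using triangulation_compact lmeasurable_compact by blast

lemma triangulation_interior: "T \<in> \<T> \<Longrightarrow> interior T \<noteq> {}"
  using triangulation_simplex triangle_interior_nonempty by blast

text \<open>A common face that reaches an interior point is the whole triangle.\<close>

lemma triangulation_disjoint_interior:
  assumes "T \<in> \<T>" "T' \<in> \<T>" "T \<noteq> T'"
  shows "T \<inter> interior T' = {}"
proof (cases "T \<inter> T' = T'")
  case False
  hence "(T \<inter> T') \<inter> interior T' = {}"
    using assms reg by (intro face_of_disjoint_interior) (auto simp: regular_triangulation_def)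
  thus ?thesis using interior_subset by blast
next
  case True
  hence "T' face_of T" "T' \<noteq> T"
    using assms reg by (metis regular_triangulation_def) (use assms in simp)
  hence "T' \<inter> interior T = {}" by (rule face_of_disjoint_interior)
  moreover have "interior T' \<subseteq> interior T"
    using True by (intro interior_mono) auto
  ultimately show ?thesis
    using triangulation_interior[OF assms(2)] interior_subset by blast
qed

lemma triangulation_negligible_overlap:
  "pairwise (\<lambda>T T'. negligible (T \<inter> T')) \<T>"
proof (rule pairwiseI)
  fix T T' assume T: "T \<in> \<T>" "T' \<in> \<T>" "T \<noteq> T'"
  hence "T \<inter> T' \<subseteq> frontier T'"
    using triangulation_disjoint_interior[OF T] closure_subset by (auto simp: frontier_def)
  thus "negligible (T \<inter> T')"
    using negligible_convex_frontier[OF triangulation_convex[OF T(2)]] negligible_subset by blast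
qed

end

text \<open>Cramer's rule with respect to the directions q - p and i - x: the barycentric coordinates of
  p and q stay positive near x, and the one of i changes sign along the line through p and q.\<close>

lemma convex_contains_half_disc:
  fixes S :: "vec2 set"
  assumes S: "convex S" "p \<in> S" "q \<in> S" "i \<in> S" and x: "x \<in> open_segment p q"
    and n: "n = vector [- (q - p)$2, (q - p)$1]" and ne: "n \<bullet> (i - x) \<noteq> 0"
  shows "eventually (\<lambda>y. 0 \<le> (n \<bullet> (y - x)) * (n \<bullet> (i - x)) \<longrightarrow> y \<in> S) (nhds x)"
proof -
  obtain l where l: "0 < l" "l < 1" "x = (1 - l) *\<^sub>R p + l *\<^sub>R q"
    using x by (auto simp: in_segment)
  define \<sigma> where "\<sigma> = n \<bullet> (i - x)"
  have inner_n: "n \<bullet> w = (q - p)$1 * w$2 - (q - p)$2 * w$1" for w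
    by (simp add: n inner_vec_def UNIV_2 vector_2 left_diff_distrib)
  have \<sigma>: "\<sigma> = (q - p)$1 * (i - x)$2 - (q - p)$2 * (i - x)$1"
    by (simp only: \<sigma>_def inner_n)
  have s0: "\<sigma> \<noteq> 0" using ne by (simp add: \<sigma>_def)
  define \<alpha> where "\<alpha> = (\<lambda>y::vec2. ((y - x)$1 * (i - x)$2 - (y - x)$2 * (i - x)$1) / \<sigma>)"
  define \<beta> where "\<beta> = (\<lambda>y::vec2. (n \<bullet> (y - x)) / \<sigma>)"
  have \<beta>: "\<beta> y = ((q - p)$1 * (y - x)$2 - (q - p)$2 * (y - x)$1) / \<sigma>" for y
    by (simp only: \<beta>_def inner_n)
  have cramer: "y - x = \<alpha> y *\<^sub>R (q - p) + \<beta> y *\<^sub>R (i - x)" for y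
  proof -
    have "(y - x)$k = \<alpha> y * (q - p)$k + \<beta> y * (i - x)$k" if "k = 1 \<or> k = 2" for k :: 2
    proof -
      have "\<sigma> * (\<alpha> y * (q - p)$k + \<beta> y * (i - x)$k) =
          ((y - x)$1 * (i - x)$2 - (y - x)$2 * (i - x)$1) * (q - p)$k +
          ((q - p)$1 * (y - x)$2 - (q - p)$2 * (y - x)$1) * (i - x)$k"
        using s0 unfolding \<alpha>_def \<beta> by (simp add: field_simps)
      also have "\<dots> = \<sigma> * (y - x)$k" (is "?l = ?r")
      proof (rule disjE[OF that])
        assume k: "k = 1" show "?l = ?r" unfolding k \<sigma> by algebra
      next
        assume k: "k = 2" show "?l = ?r" unfolding k \<sigma> by algebra
      qed
      finally show ?thesis using s0 by simp
    qed
    thus ?thesis by (simp add: vec_eq_iff forall_2)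
  qed
  have at0: "\<alpha> x = 0" "\<beta> x = 0" by (simp_all add: \<alpha>_def \<beta>_def)
  have cont: "continuous_on UNIV \<alpha>" "continuous_on UNIV \<beta>"
    unfolding \<alpha>_def \<beta>_def by (intro continuous_intros, use s0 in simp)+
  have "open {y. 0 < (1 - \<beta> y) * (1 - l) - \<alpha> y}" "open {y. 0 < (1 - \<beta> y) * l + \<alpha> y}"
    by (intro open_Collect_less continuous_intros cont)+
  from this[THEN eventually_nhds_in_open, of x]
  have "eventually (\<lambda>y. 0 < (1 - \<beta> y) * (1 - l) - \<alpha> y) (nhds x)"
       "eventually (\<lambda>y. 0 < (1 - \<beta> y) * l + \<alpha> y) (nhds x)"
    using l(1,2) at0 by simp_all
  thus ?thesis
  proof eventually_elim
    case (elim y)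
    show ?case
    proof
      assume "0 \<le> (n \<bullet> (y - x)) * (n \<bullet> (i - x))"
      hence b: "\<beta> y \<ge> 0"
      proof -
        have "\<beta> y = ((n \<bullet> (y - x)) * \<sigma>) / (\<sigma> * \<sigma>)" using s0 by (simp add: \<beta>_def)
        also have "\<dots> \<ge> 0"
          using \<open>0 \<le> (n \<bullet> (y - x)) * (n \<bullet> (i - x))\<close> unfolding \<sigma>_def[symmetric]
          by (rule divide_nonneg_nonneg) simp
        finally show ?thesis .
      qed
      have "y = x + (y - x)" by simp
      also have "\<dots> = x + (\<alpha> y *\<^sub>R (q - p) + \<beta> y *\<^sub>R (i - x))"
        by (rule arg_cong[OF cramer])
      also have "\<dots> = (1 - \<beta> y) *\<^sub>R x + (\<alpha> y *\<^sub>R (q - p) + \<beta> y *\<^sub>R i)"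
        by (simp add: scaleR_diff_left scaleR_diff_right)
      also have "\<dots> = ((1 - \<beta> y) * (1 - l) - \<alpha> y) *\<^sub>R p + ((1 - \<beta> y) * l + \<alpha> y) *\<^sub>R q + \<beta> y *\<^sub>R i"
        by (subst l(3)) (simp add: algebra_simps)
      finally have comb: "y = ((1 - \<beta> y) * (1 - l) - \<alpha> y) *\<^sub>R p + ((1 - \<beta> y) * l + \<alpha> y) *\<^sub>R q + \<beta> y *\<^sub>R i" .
      have "((1 - \<beta> y) * (1 - l) - \<alpha> y) + ((1 - \<beta> y) * l + \<alpha> y) + \<beta> y = 1"
        by (simp add: algebra_simps)
      moreover have "u *\<^sub>R p + v *\<^sub>R q + w *\<^sub>R i \<in> convex hull {p, q, i}"
        if "u \<ge> 0" "v \<ge> 0" "w \<ge> 0" "u + v + w = 1" for u v w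
        using that unfolding convex_hull_3 by blast
      ultimately have "y \<in> convex hull {p, q, i}"
        using elim b by (subst comb) (simp only: less_imp_le)
      moreover have "convex hull {p, q, i} \<subseteq> S"
        using S by (intro hull_minimal) auto
      ultimately show "y \<in> S" by blast
    qed
  qed
qed

text \<open>Two triangles sharing a point that is no corner share an edge through it.  Each contains a
  half disc on its side of that edge, and the two sides differ because the triangles do not
  overlap.\<close>

lemma two_triangles_surround:
  fixes \<T> :: "vec2 set set"
  assumes reg: "regular_triangulation \<T> S" and T: "T \<in> \<T>" "T' \<in> \<T>" "T \<noteq> T'"
    and x: "x \<in> T" "x \<in> T'" "\<not> x extreme_point_of T"
  shows "x \<in> interior (T \<union> T')"
proof -
  have "(T \<inter> T') face_of T"
    using reg T by (simp add: regular_triangulation_def)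
  hence "\<not> x extreme_point_of (T \<inter> T')"
    using x extreme_point_of_face by blast
  then obtain p q where pq: "p \<in> T" "p \<in> T'" "q \<in> T" "q \<in> T'" "x \<in> open_segment p q"
    using x by (auto simp: extreme_point_of_def)
  define n :: vec2 where "n = vector [- (q - p)$2, (q - p)$1]"
  have "p \<noteq> q" using pq by auto
  hence n0: "n \<noteq> 0"
    by (auto simp: n_def vec_eq_iff forall_2 vector_2)
  have off: "\<exists>i\<in>A. n \<bullet> (i - x) \<noteq> 0" if "A \<in> \<T>" for A
  proof (rule ccontr)
    assume "\<not> ?thesis"
    hence "A \<subseteq> {y. n \<bullet> y = n \<bullet> x}" by (auto simp: inner_diff_right)
    hence "interior A \<subseteq> interior {y. n \<bullet> y = n \<bullet> x}" by (rule interior_mono)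
    thus False using triangulation_interior[OF reg that] n0 by simp
  qed
  obtain i i' where i: "i \<in> T" "n \<bullet> (i - x) \<noteq> 0" and i': "i' \<in> T'" "n \<bullet> (i' - x) \<noteq> 0"
    using off T by blast
  have half: "eventually (\<lambda>y. (0 \<le> (n \<bullet> (y - x)) * (n \<bullet> (i - x)) \<longrightarrow> y \<in> T) \<and>
      (0 \<le> (n \<bullet> (y - x)) * (n \<bullet> (i' - x)) \<longrightarrow> y \<in> T')) (nhds x)"
    using convex_contains_half_disc[OF triangulation_convex[OF reg T(1)] pq(1,3) i(1) pq(5) n_def i(2)]
      convex_contains_half_disc[OF triangulation_convex[OF reg T(2)] pq(2,4) i'(1) pq(5) n_def i'(2)]
    by (rule eventually_conj)
  then obtain U where U: "open U" "x \<in> U"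
    "\<And>y. y \<in> U \<Longrightarrow> 0 \<le> (n \<bullet> (y - x)) * (n \<bullet> (i - x)) \<Longrightarrow> y \<in> T"
    "\<And>y. y \<in> U \<Longrightarrow> 0 \<le> (n \<bullet> (y - x)) * (n \<bullet> (i' - x)) \<Longrightarrow> y \<in> T'"
    unfolding eventually_nhds by blast
  show ?thesis
  proof (cases "0 < (n \<bullet> (i - x)) * (n \<bullet> (i' - x))")
    case True
    define s where "s = sgn (n \<bullet> (i - x))"
    define H where "H = U \<inter> {y. 0 < n \<bullet> (s *\<^sub>R (y - x))}"
    have s: "s * (n \<bullet> (i - x)) > 0" "s * (n \<bullet> (i' - x)) > 0" "s * s = 1"
      using True i(2) by (auto simp: s_def sgn_if zero_less_mult_iff)
    have "open H"
      unfolding H_def using U(1) by (intro open_Int open_Collect_less continuous_intros)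
    have pos: "0 \<le> (n \<bullet> (y - x)) * c" if "0 < s * (n \<bullet> (y - x))" "s * c > 0" for y c
    proof -
      have "(n \<bullet> (y - x)) * c = (s * s) * ((n \<bullet> (y - x)) * c)" by (simp only: s(3) mult_1_left)
      also have "\<dots> = (s * (n \<bullet> (y - x))) * (s * c)" by (simp only: mult_ac)
      finally show ?thesis using mult_pos_pos[OF that] by linarith
    qed
    have "H \<subseteq> T \<inter> T'"
    proof
      fix y assume "y \<in> H"
      hence y: "y \<in> U" "0 < s * (n \<bullet> (y - x))" by (auto simp: H_def)
      show "y \<in> T \<inter> T'"
        using U(3)[OF y(1) pos[OF y(2) s(1)]] U(4)[OF y(1) pos[OF y(2) s(2)]] by simp
    qed
    hence "H \<subseteq> T \<inter> interior T'"
      using interior_maximal[OF _ \<open>open H\<close>] by blast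
    hence "H = {}"
      using triangulation_disjoint_interior[OF reg T] by blast
    moreover
    obtain e where e: "e > 0" "ball x e \<subseteq> U"
      using U(1,2) open_contains_ball by blast
    define y where "y = x + (s * e / (2 * norm n)) *\<^sub>R n"
    have "\<bar>s\<bar> = 1" using i(2) by (simp add: s_def sgn_if)
    hence "dist x y < e"
      using n0 e(1) by (simp add: y_def dist_norm abs_mult)
    moreover have "n \<bullet> (s *\<^sub>R (y - x)) = e / (2 * norm n) * (n \<bullet> n)"
      using s(3) by (simp add: y_def mult.assoc[symmetric])
    hence "0 < n \<bullet> (s *\<^sub>R (y - x))"
      using n0 e(1) by simp
    ultimately have "y \<in> H" "H = {}"
      using e(2) by (auto simp: H_def)
    thus ?thesis by simp
  next
    case False
    have "U \<subseteq> T \<union> T'"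
    proof
      fix y assume y: "y \<in> U"
      have "0 \<le> (n \<bullet> (y - x)) * (n \<bullet> (i - x)) \<or> 0 \<le> (n \<bullet> (y - x)) * (n \<bullet> (i' - x))"
        using False by (auto simp: zero_le_mult_iff zero_less_mult_iff)
      thus "y \<in> T \<union> T'" using U(3,4) y by blast
    qed
    thus ?thesis using U(1,2) interior_maximal by blast
  qed
qed

section \<open>The period cell and the lattice\<close>

lemma Omega_subset_cbox: "Omega \<subseteq> cbox (vec (-1)) (vec 1)"
  unfolding Omega_def subset_eq Ball_def mem_box_cart vec_component mem_Collect_eq
  by (blast intro: less_imp_le)

lemma box_subset_Omega: "box (vec (-1)) (vec 1) \<subseteq> Omega"
  unfolding Omega_def subset_eq Ball_def mem_box_cart vec_component mem_Collect_eq
  by (blast intro: less_imp_le)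

lemma box_vec_nonempty: "box (vec (-1)) (vec 1 :: vec2) \<noteq> {}"
proof -
  have "0 \<in> box (vec (-1)) (vec 1 :: vec2)" by (simp add: mem_box_cart)
  thus ?thesis by blast
qed

lemma closure_Omega: "closure Omega = cbox (vec (-1)) (vec 1)"
proof
  show "closure Omega \<subseteq> cbox (vec (-1)) (vec 1)"
    by (rule closure_minimal[OF Omega_subset_cbox closed_cbox])
  show "cbox (vec (-1)) (vec 1) \<subseteq> closure Omega"
    using closure_mono[OF box_subset_Omega] closure_box[OF box_vec_nonempty] by simp
qed

lemma interior_Omega: "interior Omega = box (vec (-1)) (vec 1)"
proof
  show "interior Omega \<subseteq> box (vec (-1)) (vec 1)"
    using interior_mono[OF Omega_subset_cbox] by simp
  show "box (vec (-1)) (vec 1) \<subseteq> interior Omega"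
    by (rule interior_maximal[OF box_subset_Omega open_box])
qed

lemma mem_closure_Omega: "x \<in> closure Omega \<longleftrightarrow> (\<forall>i. \<bar>x$i\<bar> \<le> 1)"
proof -
  have "\<bar>t\<bar> \<le> 1 \<longleftrightarrow> -1 \<le> t \<and> t \<le> 1" for t :: real by linarith
  thus ?thesis by (simp add: closure_Omega mem_box_cart)
qed

lemma mem_interior_Omega: "x \<in> interior Omega \<longleftrightarrow> (\<forall>i. \<bar>x$i\<bar> < 1)"
proof -
  have "\<bar>t\<bar> < 1 \<longleftrightarrow> -1 < t \<and> t < 1" for t :: real by linarith
  thus ?thesis by (simp add: interior_Omega mem_box_cart)
qed

lemma Omega_lmeasurable: "Omega \<in> lmeasurable"
proof (rule measurable_convex)
  have "convex {x::vec2. -1 < x$i \<and> x$i \<le> 1}" for i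
  proof -
    have "{x::vec2. -1 < x$i \<and> x$i \<le> 1} = {x. inner (axis i 1) x > -1} \<inter> {x. inner (axis i 1) x \<le> 1}"
      by (auto simp: inner_axis')
    thus ?thesis by (simp only: convex_Int convex_halfspace_gt convex_halfspace_le)
  qed
  hence "convex (\<Inter>i. {x::vec2. -1 < x$i \<and> x$i \<le> 1})" by (rule convex_INT)
  moreover have "Omega = (\<Inter>i. {x. -1 < x$i \<and> x$i \<le> 1})"
    by (auto simp: Omega_def)
  ultimately show "convex Omega" by simp
  show "bounded Omega"
    by (rule bounded_subset[OF bounded_cbox Omega_subset_cbox])
qed

lemma area_Omega_pos: "area Omega > 0"
proof -
  have "ball 0 1 \<subseteq> Omega"
  proof
    fix x :: vec2 assume "x \<in> ball 0 1"
    hence "norm x < 1" by simp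
    hence "-1 < x$i \<and> x$i \<le> 1" for i using component_le_norm_cart[of x i] by linarith
    thus "x \<in> Omega" by (simp add: Omega_def)
  qed
  hence "area (ball 0 1) \<le> area Omega"
    unfolding area_def by (rule measure_mono_fmeasurable) (auto intro: Omega_lmeasurable fmeasurableD)
  thus ?thesis using area_ball_pos[of 1 0] by simp
qed

lemma period_even:
  assumes "\<xi> \<in> periods" shows "\<exists>m :: 2 \<Rightarrow> int. \<forall>i. \<xi>$i = 2 * of_int (m i)"
proof -
  from assms obtain z where z: "\<xi> = 2 *\<^sub>R z" "\<And>i. z$i \<in> \<int>"
    by (auto simp: periods_def Z2_def)
  hence "\<forall>i. \<exists>k. z$i = of_int k" by (auto elim: Ints_cases)
  then obtain m where "\<And>i. z$i = of_int (m i)" by metis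
  thus ?thesis using z(1) by auto
qed

lemma periodsI:
  assumes "\<And>i. \<xi>$i = 2 * of_int (k i)" shows "\<xi> \<in> periods"
proof -
  have "\<xi> = 2 *\<^sub>R (\<chi> i. of_int (k i))" by (simp add: vec_eq_iff assms)
  thus ?thesis by (simp add: periods_def Z2_def)
qed

lemma periods_zero: "0 \<in> periods"
  by (rule periodsI[of _ "\<lambda>_. 0"]) simp

lemma period_eq_0:
  assumes "\<xi> \<in> periods" "\<And>i. \<bar>\<xi>$i\<bar> < 2" shows "\<xi> = 0"
proof -
  obtain m :: "2 \<Rightarrow> int" where m: "\<And>i. \<xi>$i = 2 * of_int (m i)"
    using period_even[OF assms(1)] by blast
  have "m i = 0" for i
  proof -
    have "\<bar>of_int (m i) :: real\<bar> < 1" using assms(2)[of i] by (simp add: m abs_mult)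
    thus ?thesis by linarith
  qed
  thus ?thesis by (simp add: vec_eq_iff m)
qed

lemma Omega_period_eq_0:
  assumes "\<xi> \<in> periods" "x \<in> Omega" "\<xi> + x \<in> Omega" shows "\<xi> = 0"
proof (rule period_eq_0[OF assms(1)])
  fix i
  have "-1 < x$i \<and> x$i \<le> 1" "-1 < \<xi>$i + x$i \<and> \<xi>$i + x$i \<le> 1"
    using assms(2,3) by (auto simp: Omega_def)
  thus "\<bar>\<xi>$i\<bar> < 2" by linarith
qed

lemma closure_interior_Omega_period_eq_0:
  assumes "\<xi> \<in> periods" "x \<in> interior Omega" "\<xi> + x \<in> closure Omega" shows "\<xi> = 0"
proof (rule period_eq_0[OF assms(1)])
  fix i
  have "\<bar>x$i\<bar> < 1" "\<bar>\<xi>$i + x$i\<bar> \<le> 1"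
    using assms(2,3) by (auto simp: mem_interior_Omega mem_closure_Omega)
  thus "\<bar>\<xi>$i\<bar> < 2" by linarith
qed

lemma per_subset_period_eq_0:
  assumes "A \<subseteq> interior Omega" "x \<in> closure Omega" "x \<in> per A"
  shows "x \<in> A"
proof -
  obtain \<xi> a where a: "\<xi> \<in> periods" "a \<in> A" "x = \<xi> + a"
    using assms(3) by (auto simp: per_def)
  hence "\<xi> = 0" using closure_interior_Omega_period_eq_0[of \<xi> a] assms by auto
  thus ?thesis using a by simp
qed

lemma subset_per: "A \<subseteq> per A"
  using periods_zero by (force simp: per_def)

text \<open>No boundary point of the open cell belongs to a periodic copy of it, so that a connected set
  cannot pass from one copy to another.\<close>

lemma connected_within_cell:
  assumes C: "connected C" "C \<subseteq> per A" and A: "A \<subseteq> interior Omega"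
    and x: "x \<in> C" "x \<in> Omega"
  shows "C \<subseteq> A"
proof -
  have xO: "x \<in> interior Omega"
    using per_subset_period_eq_0[OF A _ ] x C closure_subset A by blast
  have fr: "C \<inter> frontier (interior Omega) = {}"
  proof -
    have "y \<in> interior Omega" if "y \<in> C" "y \<in> closure (interior Omega)" for y
    proof -
      have "y \<in> closure Omega" using that(2) closure_mono[OF interior_subset] by blast
      thus ?thesis using per_subset_period_eq_0[OF A] that(1) C(2) A by blast
    qed
    thus ?thesis by (auto simp: frontier_def)
  qed
  hence "C \<subseteq> interior Omega"
    using connected_Int_frontier[OF C(1), of "interior Omega"] x(1) xO by blast
  thus ?thesis
    using per_subset_period_eq_0[OF A] C(2) interior_subset closure_subset by blast
qed

lemma eps_pos: "N \<ge> 1 \<Longrightarrow> eps N > 0"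
  by (simp add: eps_def)

lemma Lat_subset_Omega: assumes "N \<ge> 1" shows "Lat N \<subseteq> Omega"
proof
  fix x assume x: "x \<in> Lat N"
  show "x \<in> Omega"
    unfolding Omega_def
  proof (intro CollectI allI)
    fix i
    obtain k :: int where k: "- int N + 1 \<le> k" "k \<le> int N" "x$i = eps N * of_int k"
      using x by (auto simp: Lat_def)
    have "- real N < of_int k" "of_int k \<le> real N" using k(1,2) by linarith+
    thus "-1 < x$i \<and> x$i \<le> 1"
      using assms by (simp add: k(3) eps_def field_simps)
  qed
qed

lemma finite_Lat: "finite (Lat N)"
proof (rule finite_subset)
  show "Lat N \<subseteq> (\<lambda>(a, b). vector [eps N * of_int a, eps N * of_int b]) ` ({- int N + 1..int N} \<times> {- int N + 1..int N})"
  proof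
    fix x assume x: "x \<in> Lat N"
    have k: "\<exists>k. k \<in> {- int N + 1..int N} \<and> x$i = eps N * of_int k" for i
      using x by (auto simp: Lat_def)
    obtain a b where "a \<in> {- int N + 1..int N}" "x$1 = eps N * of_int a"
       "b \<in> {- int N + 1..int N}" "x$2 = eps N * of_int b"
      using k[of 1] k[of 2] by blast
    moreover from this have "x = vector [eps N * of_int a, eps N * of_int b]"
      by (simp add: vec_eq_iff forall_2 vector_2)
    ultimately show "x \<in> (\<lambda>(a, b). vector [eps N * of_int a, eps N * of_int b]) ` ({- int N + 1..int N} \<times> {- int N + 1..int N})"
      by (intro image_eqI[of _ _ "(a, b)"]) auto
  qed
qed simp

lemma Lat_subset_Lat_per: "Lat N \<subseteq> Lat_per N"
proof
  fix x assume "x \<in> Lat N"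
  hence "\<forall>i. \<exists>k::int. x$i = eps N * of_int k" by (auto simp: Lat_def)
  then obtain k :: "2 \<Rightarrow> int" where k: "\<And>i. x$i = eps N * of_int (k i)" by metis
  have "x = eps N *\<^sub>R (\<chi> i. of_int (k i))" by (simp add: vec_eq_iff k)
  thus "x \<in> Lat_per N" by (auto simp: Lat_per_def Z2_def)
qed

lemma Lat_per_subset:
  assumes "N \<ge> 1" shows "Lat_per N \<subseteq> per (Lat N)"
proof
  fix x assume "x \<in> Lat_per N"
  then obtain z where z: "x = eps N *\<^sub>R z" "\<And>i. z$i \<in> \<int>"
    by (auto simp: Lat_per_def Z2_def)
  hence "\<forall>i. \<exists>k. z$i = of_int k" by (auto elim: Ints_cases)
  then obtain k where k: "\<And>i. z$i = of_int (k i)" by metis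
  \<comment> \<open>the shift by N - 1 makes the remainders run through the cell, which is open on the left\<close>
  define k0 where "k0 = (\<lambda>i. (k i + int N - 1) mod (2 * int N) - int N + 1)"
  define q where "q = (\<lambda>i. (k i + int N - 1) div (2 * int N))"
  have kq: "k i = 2 * int N * q i + k0 i" for i
    using div_mult_mod_eq[of "k i + int N - 1" "2 * int N"] by (simp add: k0_def q_def algebra_simps)
  have pos: "2 * int N > 0" using assms by simp
  have bd: "- int N + 1 \<le> k0 i" "k0 i \<le> int N" for i
    using pos_mod_bound[OF pos, of "k i + int N - 1"] pos_mod_sign[OF pos, of "k i + int N - 1"]
    unfolding k0_def by linarith+
  define \<xi> x0 :: vec2 where "\<xi> = (\<chi> i. 2 * of_int (q i))" and "x0 = (\<chi> i. eps N * of_int (k0 i))"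
  have "x0 \<in> Lat N" using bd by (auto simp: x0_def Lat_def)
  moreover have "\<xi> \<in> periods" by (rule periodsI[of _ q]) (simp add: \<xi>_def)
  moreover have "x = \<xi> + x0"
    using assms by (simp add: vec_eq_iff z(1) k kq \<xi>_def x0_def eps_def field_simps)
  ultimately show "x \<in> per (Lat N)" by (auto simp: per_def)
qed

lemma Lat_representative:
  assumes "N \<ge> 1" "x \<in> Lat N"
  shows "(THE x0. x0 \<in> Lat N \<and> x - x0 \<in> periods) = x"
proof (rule the_equality)
  fix x0 assume x0: "x0 \<in> Lat N \<and> x - x0 \<in> periods"
  hence "x - x0 = 0"
    using Omega_period_eq_0[of "x - x0" x0] Lat_subset_Omega[OF assms(1)] assms(2) by auto
  thus "x0 = x" by simp
qed (use assms periods_zero in simp)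

section \<open>The fine mesh\<close>

text \<open>The integer parts select the square and the fractional parts the side of its diagonal; points on
  the edges are assigned to one of their triangles arbitrarily.\<close>

definition fine_triangle_at :: "nat \<Rightarrow> bool \<Rightarrow> vec2 \<Rightarrow> vec2 set" where
  "fine_triangle_at N d x =
     (let z = (\<chi> i. of_int \<lfloor>x$i / eps N\<rfloor>); s = x$1 / eps N - z$1; t = x$2 / eps N - z$2 in
      (\<lambda>y. eps N *\<^sub>R (z + y)) `
       (if d then (if t \<le> s then convex hull {vector [0,0], vector [1,0], vector [1,1]}
                   else convex hull {vector [0,0], vector [0,1], vector [1,1]})
        else (if s + t \<le> 1 then convex hull {vector [0,0], vector [1,0], vector [0,1]}
              else convex hull {vector [1,0], vector [0,1], vector [1,1]})))"

lemma convex_hull_3_vec2: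
  "x \<in> convex hull {a, b, c :: vec2} \<longleftrightarrow>
     (\<exists>u v w. 0 \<le> u \<and> 0 \<le> v \<and> 0 \<le> w \<and> u + v + w = 1 \<and>
        x$1 = u * a$1 + v * b$1 + w * c$1 \<and> x$2 = u * a$2 + v * b$2 + w * c$2)"
  unfolding convex_hull_3 mem_Collect_eq by (intro ex_cong1) (auto simp: vec_eq_iff forall_2)

lemma mem_fine_triangle_at:
  assumes "N \<ge> 1" shows "x \<in> fine_triangle_at N d x"
proof -
  define z :: vec2 where "z = (\<chi> i. of_int \<lfloor>x$i / eps N\<rfloor>)"
  define s t where "s = x$1 / eps N - z$1" and "t = x$2 / eps N - z$2"
  have st: "0 \<le> s" "s \<le> 1" "0 \<le> t" "t \<le> 1"
    unfolding s_def t_def z_def by (simp_all, linarith+)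
  have x: "x = eps N *\<^sub>R (z + vector [s, t])"
    using eps_pos[OF assms] by (simp add: vec_eq_iff forall_2 vector_2 s_def t_def)
  have A: "vector [s, t] \<in> convex hull {vector [0,0], vector [1,0], vector [1,1] :: vec2}" if "t \<le> s"
    unfolding convex_hull_3_vec2 using st that
    by (intro exI[of _ "1 - s"] exI[of _ "s - t"] exI[of _ t]) (simp add: vector_2)
  have B: "vector [s, t] \<in> convex hull {vector [0,0], vector [0,1], vector [1,1] :: vec2}" if "s \<le> t"
    unfolding convex_hull_3_vec2 using st that
    by (intro exI[of _ "1 - t"] exI[of _ "t - s"] exI[of _ s]) (simp add: vector_2)
  have C: "vector [s, t] \<in> convex hull {vector [0,0], vector [1,0], vector [0,1] :: vec2}" if "s + t \<le> 1"
    unfolding convex_hull_3_vec2 using st that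
    by (intro exI[of _ "1 - s - t"] exI[of _ s] exI[of _ t]) (simp add: vector_2)
  have D: "vector [s, t] \<in> convex hull {vector [1,0], vector [0,1], vector [1,1] :: vec2}" if "s + t \<ge> 1"
    unfolding convex_hull_3_vec2 using st that
    by (intro exI[of _ "1 - t"] exI[of _ "1 - s"] exI[of _ "s + t - 1"]) (simp add: vector_2)
  show ?thesis
    unfolding fine_triangle_at_def Let_def z_def[symmetric] s_def[symmetric] t_def[symmetric]
    by (rule image_eqI[where x = "vector [s, t]"], rule x) (use A B C D in auto)
qed

lemma fine_triangle_at_in_mesh: "fine_triangle_at N d x \<in> Teps_per N d"
proof -
  have "(\<chi> i. of_int \<lfloor>x$i / eps N\<rfloor>) \<in> Z2" by (simp add: Z2_def)
  thus ?thesis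
    unfolding Teps_per_def fine_triangle_at_def Let_def unit_split_def by (cases d) auto
qed

lemma strict_halfspace_of_interior:
  assumes "\<And>y. y \<in> T \<Longrightarrow> a \<bullet> y \<le> b" "a \<noteq> 0" "x \<in> interior T"
  shows "a \<bullet> x < b"
proof -
  have "interior T \<subseteq> interior {y. a \<bullet> y \<le> b}" by (rule interior_mono) (use assms(1) in auto)
  thus ?thesis using assms(2,3) interior_halfspace_le by blast
qed

text \<open>At an inner point all inequalities that describe a triangle are strict, so that no other square
  and not the other side of the diagonal can compete.\<close>

lemma fine_triangle_unique:
  assumes N: "N \<ge> 1" and T: "T \<in> Teps_per N d" and x: "x \<in> interior T"
  shows "T = fine_triangle_at N d x"
proof -
  let ?e = "eps N"
  have e: "?e > 0" by (rule eps_pos[OF N])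
  obtain z T0 where z: "z \<in> Z2" and T0: "T0 \<in> unit_split d" and T_eq: "T = (\<lambda>y. ?e *\<^sub>R (z + y)) ` T0"
    using T by (auto simp: Teps_per_def)
  have strict: "a * (x$1 / ?e - z$1) + b * (x$2 / ?e - z$2) < c"
    if ab: "a \<noteq> 0 \<or> b \<noteq> 0" and le: "\<And>y. y \<in> T0 \<Longrightarrow> a * y$1 + b * y$2 \<le> c" for a b c
  proof -
    have "vector [a, b] \<bullet> y \<le> ?e * (c + a * z$1 + b * z$2)" if "y \<in> T" for y :: vec2
    proof -
      obtain w where w: "w \<in> T0" "y = ?e *\<^sub>R (z + w)" using \<open>y \<in> T\<close> T_eq by auto
      have "vector [a, b] \<bullet> y = ?e * ((a * w$1 + b * w$2) + a * z$1 + b * z$2)"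
        by (simp add: w(2) inner_vec_def UNIV_2 vector_2 algebra_simps)
      thus ?thesis using le[OF w(1)] e by simp
    qed
    moreover have "vector [a, b] \<noteq> (0 :: vec2)"
      using ab by (auto simp: vec_eq_iff forall_2 vector_2)
    ultimately have "vector [a, b] \<bullet> x < ?e * (c + a * z$1 + b * z$2)"
      using strict_halfspace_of_interior x by blast
    hence "a * x$1 + b * x$2 < ?e * (c + a * z$1 + b * z$2)"
      by (simp add: inner_vec_def UNIV_2 vector_2)
    hence "(a * x$1 + b * x$2) / ?e < c + a * z$1 + b * z$2"
      using e by (simp add: pos_divide_less_eq mult.commute)
    moreover have "(a * x$1 + b * x$2) / ?e = a * (x$1 / ?e) + b * (x$2 / ?e)"
      by (simp add: add_divide_distrib)
    ultimately show ?thesis by (simp add: algebra_simps)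
  qed
  have T0_cases: "T0 = convex hull {vector [0,0], vector [1,0], vector [1,1]} \<and> d \<or>
      T0 = convex hull {vector [0,0], vector [0,1], vector [1,1]} \<and> d \<or>
      T0 = convex hull {vector [0,0], vector [1,0], vector [0,1]} \<and> \<not> d \<or>
      T0 = convex hull {vector [1,0], vector [0,1], vector [1,1]} \<and> \<not> d"
    using T0 by (auto simp: unit_split_def split: if_splits)
  have unit: "0 \<le> y$1" "y$1 \<le> 1" "0 \<le> y$2" "y$2 \<le> 1" if "y \<in> T0" for y
    using T0_cases that by (auto simp: convex_hull_3_vec2 vector_2)
  define s t where "s = x$1 / ?e - z$1" and "t = x$2 / ?e - z$2"
  have st: "0 < s" "s < 1" "0 < t" "t < 1"
    using strict[of "-1" 0 0] strict[of 1 0 1] strict[of 0 "-1" 0] strict[of 0 1 1] unit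
    by (auto simp: s_def t_def)
  have fl: "of_int \<lfloor>x$i / ?e\<rfloor> = z$i" for i
  proof -
    obtain k where k: "z$i = of_int k" using z by (auto simp: Z2_def elim: Ints_cases)
    have "0 < x$i / ?e - z$i" "x$i / ?e - z$i < 1"
      using st exhaust_2[of i] by (auto simp: s_def t_def)
    hence "\<lfloor>x$i / ?e\<rfloor> = k" by (intro floor_unique) (auto simp: k)
    thus ?thesis by (simp add: k)
  qed
  hence zeq: "(\<chi> i. of_int \<lfloor>x$i / ?e\<rfloor>) = z" by (simp add: vec_eq_iff)
  have which: "T0 = (if d then (if t \<le> s then convex hull {vector [0,0], vector [1,0], vector [1,1]}
                   else convex hull {vector [0,0], vector [0,1], vector [1,1]})
        else (if s + t \<le> 1 then convex hull {vector [0,0], vector [1,0], vector [0,1]}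
              else convex hull {vector [1,0], vector [0,1], vector [1,1]}))"
    using T0_cases
  proof (elim disjE conjE)
    assume h: "T0 = convex hull {vector [0,0], vector [1,0], vector [1,1]}" "d"
    have "(-1) * y$1 + (1) * y$2 \<le> 0" if "y \<in> T0" for y
      using that by (auto simp: h(1) convex_hull_3_vec2 vector_2)
    from strict[OF _ this] have "t < s" by (auto simp: s_def t_def)
    thus ?thesis using h by simp
  next
    assume h: "T0 = convex hull {vector [0,0], vector [0,1], vector [1,1]}" "d"
    have "(1) * y$1 + (-1) * y$2 \<le> 0" if "y \<in> T0" for y
      using that by (auto simp: h(1) convex_hull_3_vec2 vector_2)
    from strict[OF _ this] have "s < t" by (auto simp: s_def t_def)
    thus ?thesis using h by simp
  next
    assume h: "T0 = convex hull {vector [0,0], vector [1,0], vector [0,1]}" "\<not> d"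
    have "(1) * y$1 + (1) * y$2 \<le> 1" if "y \<in> T0" for y
      using that by (auto simp: h(1) convex_hull_3_vec2 vector_2)
    from strict[OF _ this] have "s + t < 1" by (auto simp: s_def t_def)
    thus ?thesis using h by simp
  next
    assume h: "T0 = convex hull {vector [1,0], vector [0,1], vector [1,1]}" "\<not> d"
    have "(-1) * y$1 + (-1) * y$2 \<le> -1" if "y \<in> T0" for y
      using that by (auto simp: h(1) convex_hull_3_vec2 vector_2)
    from strict[OF _ this] have "s + t > 1" by (auto simp: s_def t_def)
    thus ?thesis using h by simp
  qed
  show ?thesis
    unfolding T_eq fine_triangle_at_def Let_def zeq s_def[symmetric] t_def[symmetric] which[symmetric] ..
qed

lemma fine_triangle_convex:
  assumes "T \<in> Teps_per N d" shows "convex T"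
proof -
  obtain z T0 where "T0 \<in> unit_split d" "T = (\<lambda>x. eps N *\<^sub>R (z + x)) ` T0"
    using assms by (auto simp: Teps_per_def)
  hence T: "T0 \<in> unit_split d" "T = (\<lambda>x. eps N *\<^sub>R x) ` (\<lambda>x. z + x) ` T0"
    by (simp_all add: image_image)
  have "convex T0"
    using T(1) by (auto simp: unit_split_def split: if_splits)
  thus ?thesis unfolding T(2) by (intro convex_scaling convex_translation)
qed

lemma countable_fine_mesh: "countable (Teps_per N d)"
proof -
  have "Z2 \<subseteq> range (\<lambda>(a, b). vector [of_int a, of_int b])"
  proof
    fix z assume "z \<in> Z2"
    then obtain a b where "z$1 = of_int a" "z$2 = of_int b"
      by (auto simp: Z2_def elim!: Ints_cases) (metis Ints_cases)
    hence "z = (\<lambda>(a, b). vector [of_int a, of_int b]) (a, b)"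
      by (simp add: vec_eq_iff forall_2 vector_2)
    thus "z \<in> range (\<lambda>(a, b). vector [of_int a, of_int b])" by blast
  qed
  hence "countable Z2" by (rule countable_subset) simp
  moreover have "finite (unit_split d)" by (simp add: unit_split_def)
  ultimately have "countable (Z2 \<times> unit_split d)"
    by (intro countable_SIGMA) (auto intro: countable_finite)
  moreover have "Teps_per N d = (\<lambda>(z, T). (\<lambda>x. eps N *\<^sub>R (z + x)) ` T) ` (Z2 \<times> unit_split d)"
    by (auto simp: Teps_per_def)
  ultimately show ?thesis by simp
qed

lemma negligible_fine_edges: "negligible (\<Union>T\<in>Teps_per N d. frontier T)"
  using countable_fine_mesh fine_triangle_convex
  by (intro negligible_countable_Union) (auto intro: negligible_convex_frontier)

text \<open>The corners of the cell are lattice points, so that no fine triangle with an inner point in the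
  cell crosses its boundary.\<close>

lemma fine_triangle_in_cell:
  assumes N: "N \<ge> 1" and x: "x \<in> Omega" "x \<notin> (\<Union>T\<in>Teps_per N d. frontier T)"
  obtains T where "T \<in> Teps N d" "x \<in> interior T"
proof -
  let ?T = "fine_triangle_at N d x" and ?e = "eps N"
  have e: "?e > 0" by (rule eps_pos[OF N])
  have int: "x \<in> interior ?T"
    using x(2) fine_triangle_at_in_mesh mem_fine_triangle_at[OF N] closure_subset
    by (fastforce simp: frontier_def)
  obtain z T0 where z: "z \<in> Z2" and T0: "T0 \<in> unit_split d" and T_eq: "?T = (\<lambda>y. ?e *\<^sub>R (z + y)) ` T0"
    using fine_triangle_at_in_mesh[of N d x] by (auto simp: Teps_per_def)
  have unit: "0 \<le> y$i" "y$i \<le> 1" if "y \<in> T0" for y i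
    using T0 that exhaust_2[of i]
    by (auto simp: unit_split_def convex_hull_3_vec2 vector_2 split: if_splits)
  have "\<bar>y$i\<bar> \<le> 1" if "y \<in> ?T" for y i
  proof -
    obtain k where k: "z$i = of_int k" using z by (auto simp: Z2_def elim: Ints_cases)
    have bd: "?e * of_int k \<le> w$i \<and> w$i \<le> ?e * (of_int k + 1)" if "w \<in> ?T" for w
      using that unit e unfolding T_eq by (auto simp: k)
    have l: "?e * of_int k < x$i"
      using strict_halfspace_of_interior[OF _ _ int, of "axis i (-1)" "- (?e * of_int k)"] bd
      by (auto simp: inner_axis' axis_eq_0_iff)
    have u: "x$i < ?e * (of_int k + 1)"
      using strict_halfspace_of_interior[OF _ _ int, of "axis i 1" "?e * (of_int k + 1)"] bd
      by (auto simp: inner_axis' axis_eq_0_iff)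
    have xi: "-1 < x$i" "x$i \<le> 1" using x(1) by (auto simp: Omega_def)
    have "?e * of_int k < 1" "-1 < ?e * (of_int k + 1)" using l u xi by linarith+
    hence "of_int k < real N" "- real N < of_int k + 1"
      using N by (auto simp: eps_def field_simps)
    hence "k \<le> int N - 1" "- int N \<le> k" by linarith+
    hence "of_int k + 1 \<le> real N" "- real N \<le> of_int k" by linarith+
    hence "?e * (of_int k + 1) \<le> 1" "-1 \<le> ?e * of_int k"
      using N by (auto simp: eps_def field_simps)
    thus ?thesis using bd[OF \<open>y \<in> ?T\<close>] by linarith
  qed
  hence "?T \<subseteq> closure Omega" by (auto simp: mem_closure_Omega)
  hence "?T \<in> Teps N d" using fine_triangle_at_in_mesh by (simp add: Teps_def)
  thus ?thesis using that int by blast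
qed

section \<open>A compactly supported piecewise affine field with prescribed inner gradient\<close>

lemma affine_maps_agree:
  fixes A A' :: mat2
  assumes T: "compact T" "convex T"
    and ext: "\<And>v. v extreme_point_of T \<Longrightarrow> A *v v + b = A' *v v + b'" and x: "x \<in> T"
  shows "A *v x + b = A' *v x + b'"
proof -
  have "linear (\<lambda>x. A *v x - A' *v x)"
    by (intro linear_compose_sub matrix_vector_mul_linear)
  hence "convex {x. A *v x - A' *v x \<in> {b' - b}}"
    using convex_linear_vimage[of "\<lambda>x. A *v x - A' *v x" "{b' - b}"] by (simp add: vimage_def)
  moreover have eq: "{x. A *v x - A' *v x \<in> {b' - b}} = {x. A *v x + b = A' *v x + b'}"
    by (auto simp: algebra_simps)
  ultimately have "convex {x. A *v x + b = A' *v x + b'}" by simp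
  hence "convex hull {v. v extreme_point_of T} \<subseteq> {x. A *v x + b = A' *v x + b'}"
    by (intro hull_minimal) (auto intro: ext)
  thus ?thesis using Krein_Milman_Minkowski[OF T] x by blast
qed

lemma affine_interpolant_exists:
  fixes T :: "vec2 set" and \<phi> :: "vec2 \<Rightarrow> vec2"
  assumes "2 simplex T"
  shows "\<exists>A b. \<forall>v. v extreme_point_of T \<longrightarrow> A *v v + b = \<phi> v"
proof -
  obtain C where C: "\<not> affine_dependent C" "int (card C) = 2 + 1" "T = convex hull C"
    using assms by (auto simp: simplex_def)
  have ext: "v extreme_point_of T \<longleftrightarrow> v \<in> C" for v
    unfolding C(3) by (rule extreme_point_of_convex_hull_affine_independent[OF C(1)])
  obtain a where a: "a \<in> C" using C(2) by fastforce
  have "independent ((\<lambda>x. -a + x) ` (C - {a}))"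
    using C(1) affine_dependent_iff_dependent2[OF a] by blast
  from linear_independent_extend[OF this, of "\<lambda>x. \<phi> (x + a) - \<phi> a"]
  obtain g where g: "linear g" "\<And>x. x \<in> (\<lambda>x. -a + x) ` (C - {a}) \<Longrightarrow> g x = \<phi> (x + a) - \<phi> a"
    by blast
  have gA: "matrix g *v x = g x" for x
    using g(1) by (intro matrix_works) (simp add: linear_def scalar_mult_eq_scaleR[abs_def])
  have "matrix g *v v + (\<phi> a - matrix g *v a) = \<phi> v" if "v \<in> C" for v
  proof (cases "v = a")
    case False
    hence "g (-a + v) = \<phi> v - \<phi> a" using that g(2)[of "-a + v"] by auto
    thus ?thesis using linear_diff[OF g(1), of v a] by (simp add: gA algebra_simps)
  qed simp
  thus ?thesis using ext by blast
qed

text \<open>The local affine interpolants fit together because two triangles meet in a face, whose points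
  are convex combinations of common corners.\<close>

lemma piecewise_affine_interpolation:
  fixes \<phi> :: "vec2 \<Rightarrow> vec2"
  assumes reg: "regular_triangulation \<T> S"
  shows "\<exists>u. \<forall>T\<in>\<T>. (\<exists>A b. \<forall>x\<in>T. u x = A *v x + b) \<and> (\<forall>v. v extreme_point_of T \<longrightarrow> u v = \<phi> v)"
proof -
  have "\<forall>T\<in>\<T>. \<exists>q. \<forall>v. v extreme_point_of T \<longrightarrow> fst q *v v + snd q = \<phi> v"
    using affine_interpolant_exists triangulation_simplex[OF reg] by (metis fst_conv snd_conv)
  then obtain q where q: "\<And>T v. T \<in> \<T> \<Longrightarrow> v extreme_point_of T \<Longrightarrow> fst (q T) *v v + snd (q T) = \<phi> v"
    by metis
  have agree: "fst (q T) *v x + snd (q T) = fst (q T') *v x + snd (q T')"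
    if "T \<in> \<T>" "T' \<in> \<T>" "x \<in> T" "x \<in> T'" for T T' x
  proof (rule affine_maps_agree[of "T \<inter> T'"])
    have face: "(T \<inter> T') face_of T" "(T \<inter> T') face_of T'"
      using reg that by (auto simp: regular_triangulation_def)
    show "compact (T \<inter> T')" "convex (T \<inter> T')"
      using triangulation_compact[OF reg] triangulation_convex[OF reg] that
      by (auto intro: compact_Int convex_Int)
    show "fst (q T) *v v + snd (q T) = fst (q T') *v v + snd (q T')" if "v extreme_point_of (T \<inter> T')" for v
    proof -
      have "v extreme_point_of T" "v extreme_point_of T'"
        using that extreme_point_of_face[OF face(1)] extreme_point_of_face[OF face(2)] by blast+
      thus ?thesis using q \<open>T \<in> \<T>\<close> \<open>T' \<in> \<T>\<close> by simp
    qed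
  qed (use that in auto)
  define u where "u = (\<lambda>x. let T = (SOME T. T \<in> \<T> \<and> x \<in> T) in fst (q T) *v x + snd (q T))"
  have u: "u x = fst (q T) *v x + snd (q T)" if "T \<in> \<T>" "x \<in> T" for T x
  proof -
    have "(SOME T. T \<in> \<T> \<and> x \<in> T) \<in> \<T> \<and> x \<in> (SOME T. T \<in> \<T> \<and> x \<in> T)"
      by (rule someI[of _ T]) (use that in simp)
    hence "fst (q (SOME T. T \<in> \<T> \<and> x \<in> T)) *v x + snd (q (SOME T. T \<in> \<T> \<and> x \<in> T)) =
        fst (q T) *v x + snd (q T)"
      using agree[OF _ that(1) _ that(2)] by blast
    thus ?thesis by (simp only: u_def Let_def)
  qed
  have "(\<exists>A b. \<forall>x\<in>T. u x = A *v x + b) \<and> (\<forall>v. v extreme_point_of T \<longrightarrow> u v = \<phi> v)" if "T \<in> \<T>" for T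
    using u[OF that] q[OF that] by (auto simp: extreme_point_of_def)
  thus ?thesis by blast
qed

text \<open>Nodal values G v at the inner corners and 0 at the corners on the boundary give a field that
  vanishes on the whole boundary, since boundary points only combine boundary corners.\<close>

lemma cut_off_linear_field:
  fixes G :: mat2
  assumes reg: "regular_triangulation \<T> (closure Omega)"
  obtains w where "\<And>T. T \<in> \<T> \<Longrightarrow> \<exists>A b. \<forall>x\<in>T. w x = A *v x + b"
    and "\<And>x. x \<notin> interior Omega \<Longrightarrow> w x = 0"
    and "\<And>T x. T \<in> \<T> \<Longrightarrow> T \<subseteq> interior Omega \<Longrightarrow> x \<in> T \<Longrightarrow> w x = G *v x"
proof -
  define \<phi> where "\<phi> = (\<lambda>v. if v \<in> interior Omega then G *v v else 0)"
  obtain u where aff: "\<And>T. T \<in> \<T> \<Longrightarrow> \<exists>A b. \<forall>x\<in>T. u x = A *v x + b"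
    and nod: "\<And>T v. T \<in> \<T> \<Longrightarrow> v extreme_point_of T \<Longrightarrow> u v = \<phi> v"
    using piecewise_affine_interpolation[OF reg, of \<phi>] by blast
  have cover: "\<Union>\<T> = closure Omega" using reg by (simp add: regular_triangulation_def)
  have ext_in: "v \<in> T" if "v extreme_point_of T" for v and T :: "vec2 set"
    using that by (simp add: extreme_point_of_def)
  have bdry: "u x = 0" if T: "T \<in> \<T>" and x: "x \<in> T" "x \<notin> interior Omega" for T x
  proof -
    have sub: "T \<subseteq> closure Omega" using T cover by blast
    obtain i where "\<not> \<bar>x$i\<bar> < 1" using x(2) unfolding mem_interior_Omega by blast
    moreover have "\<bar>x$i\<bar> \<le> 1" using x(1) sub mem_closure_Omega by blast
    ultimately have i: "\<bar>x$i\<bar> = 1" by linarith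
    define a :: vec2 where "a = axis i (x$i)"
    have a: "a \<bullet> y = x$i * y$i" for y by (simp add: a_def inner_axis')
    define F where "F = T \<inter> {y. a \<bullet> y = 1}"
    have "a \<bullet> y \<le> 1" if "y \<in> T" for y
    proof -
      have "\<bar>a \<bullet> y\<bar> \<le> 1" using that sub i by (auto simp: a abs_mult mem_closure_Omega)
      thus ?thesis by simp
    qed
    hence F: "F face_of T"
      unfolding F_def by (intro face_of_Int_supporting_hyperplane_le triangulation_convex[OF reg T])
    have xF: "x \<in> F" using x i by (auto simp: F_def a abs_if split: if_splits)
    obtain A b where Ab: "\<And>y. y \<in> T \<Longrightarrow> u y = A *v y + b" using aff[OF T] by blast
    have "A *v x + b = 0 *v x + 0"
    proof (rule affine_maps_agree[OF _ _ _ xF])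
      show "compact F" "convex F"
        using F face_of_imp_compact face_of_imp_convex triangulation_compact[OF reg T] triangulation_convex[OF reg T]
        by blast+
      fix v assume v: "v extreme_point_of F"
      hence vT: "v extreme_point_of T" and vF: "v \<in> F"
        using extreme_point_of_face[OF F] by auto
      have "x$i * v$i = 1" using vF by (simp add: F_def a)
      hence "\<bar>v$i\<bar> = 1" using i by (metis abs_mult abs_one mult_1)
      hence "v \<notin> interior Omega" by (auto simp: mem_interior_Omega intro!: exI[of _ i])
      hence "u v = 0" using nod[OF T vT] by (simp add: \<phi>_def)
      thus "A *v v + b = 0 *v v + 0" using Ab[OF ext_in[OF vT]] by simp
    qed
    thus ?thesis using Ab[OF x(1)] by simp
  qed
  define w where "w = (\<lambda>x. if x \<in> closure Omega then u x else 0)"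
  have wu: "w x = u x" if "T \<in> \<T>" "x \<in> T" for T x
    using that cover by (auto simp: w_def)
  show thesis
  proof
    show "\<exists>A b. \<forall>x\<in>T. w x = A *v x + b" if "T \<in> \<T>" for T
      using aff[OF that] wu[OF that] by auto
    show "w x = 0" if "x \<notin> interior Omega" for x
      using bdry that cover unfolding w_def by (metis Union_iff)
    show "w x = G *v x" if T: "T \<in> \<T>" "T \<subseteq> interior Omega" and x: "x \<in> T" for T x
    proof -
      obtain A b where Ab: "\<And>y. y \<in> T \<Longrightarrow> u y = A *v y + b" using aff[OF T(1)] by blast
      have "A *v x + b = G *v x + 0"
      proof (rule affine_maps_agree[OF triangulation_compact[OF reg T(1)] triangulation_convex[OF reg T(1)] _ x])
        fix v assume v: "v extreme_point_of T"
        have "v \<in> T" by (rule ext_in[OF v])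
        hence "u v = G *v v" using nod[OF T(1) v] T(2) by (auto simp: \<phi>_def)
        thus "A *v v + b = G *v v + 0" using Ab[OF \<open>v \<in> T\<close>] by simp
      qed
      thus ?thesis using wu[OF T(1) x] Ab[OF x] by simp
    qed
  qed
qed

text \<open>A segment is covered by finitely many closed pieces on each of which the field has one of
  finitely many slopes.\<close>

lemma piecewise_affine_lipschitz:
  assumes fin: "finite \<T>" and cl: "\<And>T. T \<in> \<T> \<Longrightarrow> closed T" and cover: "\<Union>\<T> = closure Omega"
    and aff: "\<And>T. T \<in> \<T> \<Longrightarrow> \<exists>(A::mat2) b. \<forall>x\<in>T. w x = A *v x + b"
    and zero: "\<And>x. x \<notin> interior Omega \<Longrightarrow> w x = 0"
  obtains M where "M-lipschitz_on UNIV w"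
proof -
  obtain A b where Ab: "\<And>T x. T \<in> \<T> \<Longrightarrow> x \<in> T \<Longrightarrow> w x = A T *v x + b T"
    using aff by metis
  define M where "M = (\<Sum>T\<in>\<T>. onorm (\<lambda>x. A T *v x))"
  have blA: "bounded_linear (\<lambda>x. A T *v x)" for T
    by (rule matrix_vector_mul_bounded_linear)
  have M0: "M \<ge> 0" unfolding M_def by (intro sum_nonneg onorm_pos_le blA)
  have onM: "onorm (\<lambda>x. A T *v x) \<le> M" if "T \<in> \<T>" for T
    unfolding M_def using that fin by (intro member_le_sum onorm_pos_le blA) auto
  have loc: "norm (w x - w y) \<le> M * norm (x - y)"
    if "C \<in> insert (- interior Omega) \<T>" "x \<in> C" "y \<in> C" for C x y
  proof (cases "C \<in> \<T>")
    case True
    have "w x - w y = A C *v (x - y)"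
      using Ab[OF True] that by (simp add: matrix_vector_mult_diff_distrib)
    also have "norm \<dots> \<le> onorm (\<lambda>x. A C *v x) * norm (x - y)"
      by (rule onorm[OF blA])
    also have "\<dots> \<le> M * norm (x - y)"
      by (intro mult_right_mono onM True) simp
    finally show ?thesis .
  next
    case False
    thus ?thesis using that zero M0 by auto
  qed
  have "dist (w x) (w y) \<le> M * dist x y" for x y
  proof -
    define p where "p = (\<lambda>t::real. x + t *\<^sub>R (y - x))"
    have pd: "p s - p t = (s - t) *\<^sub>R (y - x)" for s t by (simp add: p_def algebra_simps)
    have "lipschitz_on (M * norm (y - x)) {0..1} (\<lambda>t. w (p t))"
    proof (rule lipschitz_on_closed_Union[where I = "insert (- interior Omega) \<T>" and U = "\<lambda>C. p -` C"])
      show "(M * norm (y - x))-lipschitz_on (p -` C) (\<lambda>t. w (p t))" if "C \<in> insert (- interior Omega) \<T>" for C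
      proof (rule lipschitz_onI)
        fix s t assume "s \<in> p -` C" "t \<in> p -` C"
        hence "norm (w (p s) - w (p t)) \<le> M * norm (p s - p t)"
          using loc[OF that] by simp
        thus "dist (w (p s)) (w (p t)) \<le> M * norm (y - x) * dist s t"
          by (simp add: pd dist_norm mult_ac)
      qed (use M0 in simp)
      have "continuous_on UNIV p" unfolding p_def by (intro continuous_intros)
      thus "closed (p -` C)" if "C \<in> insert (- interior Omega) \<T>" for C
        using that cl by (intro closed_vimage) auto
      have "closure Omega \<union> - interior Omega = UNIV" using interior_subset closure_subset by blast
      hence "\<Union>(insert (- interior Omega) \<T>) = UNIV" using cover by auto
      thus "{0..1} \<subseteq> (\<Union>C\<in>insert (- interior Omega) \<T>. p -` C)" by fastforce
    qed (use fin M0 in auto)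
    from lipschitz_onD[OF this, of 0 1] show ?thesis
      by (simp add: p_def dist_norm norm_minus_commute)
  qed
  hence "M-lipschitz_on UNIV w" using M0 by (intro lipschitz_onI) auto
  thus ?thesis by (rule that)
qed

text \<open>The difference quotients of a compactly supported function integrate to zero by translation
  invariance, and for a Lipschitz function this passes to the limit by dominated convergence.\<close>

lemma piecewise_affine_mean_gradient_0:
  assumes reg: "regular_triangulation \<T> (closure Omega)" and fin: "finite \<T>"
    and lip: "M-lipschitz_on UNIV w"
    and Ab: "\<And>T x. T \<in> \<T> \<Longrightarrow> x \<in> T \<Longrightarrow> w x = (A T :: mat2) *v x + b T"
    and zero: "\<And>x. x \<notin> interior Omega \<Longrightarrow> w x = 0"
  shows "(\<Sum>T\<in>\<T>. area T *\<^sub>R A T) = 0"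
proof -
  have cover: "\<Union>\<T> = closure Omega" using reg by (simp add: regular_triangulation_def)
  have "(\<Sum>T\<in>\<T>. area T *\<^sub>R (A T *v e)) = 0" for e
  proof -
    define f where "f = (\<lambda>k x. real (Suc k) *\<^sub>R (w (x + (1 / real (Suc k)) *\<^sub>R e) - w x))"
    define g where "g = (\<lambda>x. \<Sum>T\<in>\<T>. indicat_real T x *\<^sub>R (A T *v e))"
    define Z where "Z = (\<Union>T\<in>\<T>. frontier T)"
    have Z: "negligible Z"
      unfolding Z_def using fin triangulation_convex[OF reg] negligible_convex_frontier
      by (intro negligible_Union) auto
    have contw: "continuous_on UNIV w" using lip by (rule lipschitz_on_continuous_on)
    \<comment> \<open>a box that contains the cell and all its translates by the steps in use\<close>
    define c where "c = (vec (2 + norm e) :: vec2)"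
    define Q where "Q = cbox (- c) c"
    have outQ: "w (x + t *\<^sub>R e) = 0" if "x \<notin> Q" "\<bar>t\<bar> \<le> 1" for x t
    proof (rule zero)
      have "\<not> (\<forall>i. - (2 + norm e) \<le> x$i \<and> x$i \<le> 2 + norm e)"
        using that(1) by (simp add: Q_def mem_box_cart c_def)
      then obtain i where "\<not> (- (2 + norm e) \<le> x$i \<and> x$i \<le> 2 + norm e)" by blast
      hence i: "\<bar>x$i\<bar> > 2 + norm e" by linarith
      have "\<bar>t * e$i\<bar> \<le> norm e"
        using that(2) component_le_norm_cart[of e i] mult_mono[of "\<bar>t\<bar>" 1 "\<bar>e$i\<bar>" "norm e"]
        by (simp add: abs_mult)
      hence "\<not> \<bar>(x + t *\<^sub>R e)$i\<bar> < 1" using i by simp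
      thus "x + t *\<^sub>R e \<notin> interior Omega" unfolding mem_interior_Omega by blast
    qed
    have int0: "(f k has_integral 0) UNIV" for k
    proof -
      define t where "t = 1 / real (Suc k)"
      have t: "0 < t" "\<bar>t\<bar> \<le> 1" by (auto simp: t_def)
      have wQ: "(w has_integral integral Q w) Q"
        unfolding Q_def by (intro integrable_integral integrable_continuous continuous_on_subset[OF contw]) simp
      have w: "(w has_integral integral Q w) UNIV"
        by (rule has_integral_on_superset[OF wQ]) (use outQ[of _ 0] in auto)
      have "((\<lambda>x. w (x + t *\<^sub>R e)) has_integral integral Q w) (cbox (- c - t *\<^sub>R e) (c - t *\<^sub>R e))"
        using has_integral_shift_cbox[of w "integral Q w" "-c" c "t *\<^sub>R e"] wQ
        by (simp add: Q_def add.commute)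
      moreover have "w (x + t *\<^sub>R e) = 0" if "x \<notin> cbox (- c - t *\<^sub>R e) (c - t *\<^sub>R e)" for x
      proof -
        have "x + t *\<^sub>R e \<notin> Q"
          using that by (auto simp: Q_def mem_box_cart algebra_simps)
        thus ?thesis using outQ[of "x + t *\<^sub>R e" 0] by simp
      qed
      ultimately have "((\<lambda>x. w (x + t *\<^sub>R e)) has_integral integral Q w) UNIV"
        using has_integral_on_superset by blast
      from has_integral_cmul[OF has_integral_diff[OF this w], of "real (Suc k)"]
      show ?thesis by (simp add: f_def t_def)
    qed
    have intc: "integral (UNIV - Z) (f k) = 0" "f k integrable_on (UNIV - Z)" for k
    proof -
      have "(f k has_integral 0) (UNIV - Z)"
        using int0[of k] has_integral_spike_set_eq[of UNIV "UNIV - Z" "f k" 0] Z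
        by (auto intro: negligible_subset)
      thus "integral (UNIV - Z) (f k) = 0" "f k integrable_on (UNIV - Z)"
        by (auto simp: has_integral_iff)
    qed
    have bound: "norm (f k x) \<le> M * norm e * indicat_real Q x" for k x
    proof (cases "x \<in> Q")
      case True
      have "dist (w (x + (1 / real (Suc k)) *\<^sub>R e)) (w x) \<le> M * dist (x + (1 / real (Suc k)) *\<^sub>R e) x"
        by (rule lipschitz_onD[OF lip]) auto
      hence "norm (w (x + (1 / real (Suc k)) *\<^sub>R e) - w x) \<le> M * (norm e / real (Suc k))"
        by (simp add: dist_norm)
      from mult_left_mono[OF this, of "real (Suc k)"]
      have "norm (f k x) \<le> real (Suc k) * (M * (norm e / real (Suc k)))"
        by (simp add: f_def del: of_nat_Suc)
      also have "\<dots> = M * norm e" by (simp del: of_nat_Suc)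
      finally show ?thesis using True by simp
    next
      case False
      thus ?thesis using outQ[OF False, of "1 / real (Suc k)"] outQ[OF False, of 0] by (simp add: f_def)
    qed
    have h: "(\<lambda>x. M * norm e * indicat_real Q x) integrable_on (UNIV - Z)"
    proof -
      have "indicat_real Q integrable_on UNIV"
        using lmeasurable_iff_has_integral[of Q] by (auto simp: Q_def lmeasurable_cbox)
      hence "(\<lambda>x. M * norm e * indicat_real Q x) integrable_on UNIV"
        using integrable_cmul[of "indicat_real Q" UNIV "M * norm e"] by simp
      thus ?thesis
        using integrable_spike_set[of _ UNIV "UNIV - Z"] Z by (auto intro: negligible_subset)
    qed
    have conv: "(\<lambda>k. f k x) \<longlonglongrightarrow> g x" if x: "x \<in> UNIV - Z" for x
    proof -
      have small: "(\<lambda>k. x + (1 / real (Suc k)) *\<^sub>R e) \<longlonglongrightarrow> x"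
      proof -
        have "(\<lambda>k. x + (1 / real (Suc k)) *\<^sub>R e) \<longlonglongrightarrow> x + 0 *\<^sub>R e"
          by (intro tendsto_intros LIMSEQ_Suc[OF lim_1_over_n])
        thus ?thesis by simp
      qed
      show ?thesis
      proof (cases "x \<in> closure Omega")
        case True
        then obtain T where T: "T \<in> \<T>" "x \<in> T" using cover by blast
        hence xT: "x \<in> interior T"
          using x closure_subset by (fastforce simp: Z_def frontier_def)
        have "x \<notin> T'" if "T' \<in> \<T>" "T' \<noteq> T" for T'
          using triangulation_disjoint_interior[OF reg that(1) T(1) that(2)] xT by blast
        hence "g x = (\<Sum>T'\<in>\<T>. if T' = T then A T *v e else 0)"
          unfolding g_def by (intro sum.cong) (use T in auto)
        hence gx: "g x = A T *v e" using fin T by simp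
        have "eventually (\<lambda>k. x + (1 / real (Suc k)) *\<^sub>R e \<in> interior T) sequentially"
          by (rule topological_tendstoD[OF small open_interior xT])
        hence "eventually (\<lambda>k. f k x = A T *v e) sequentially"
        proof eventually_elim
          case (elim k)
          have "w (x + (1 / real (Suc k)) *\<^sub>R e) - w x = (1 / real (Suc k)) *\<^sub>R (A T *v e)"
            using Ab[OF T] Ab[OF T(1) subsetD[OF interior_subset elim]]
            by (simp add: matrix_vector_right_distrib matrix_vector_mult_scaleR del: of_nat_Suc)
          thus ?case by (simp add: f_def del: of_nat_Suc)
        qed
        thus ?thesis unfolding gx by (rule tendsto_eventually)
      next
        case False
        hence "x \<notin> T" if "T \<in> \<T>" for T using that cover by blast
        hence gx: "g x = 0" by (simp add: g_def)
        have "x \<in> - closure Omega" using False by simp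
        hence "eventually (\<lambda>k. x + (1 / real (Suc k)) *\<^sub>R e \<in> - closure Omega) sequentially"
          by (intro topological_tendstoD[OF small]) auto
        hence "eventually (\<lambda>k. f k x = 0) sequentially"
        proof eventually_elim
          case (elim k)
          have "w y = 0" if "y \<notin> closure Omega" for y
            using that interior_subset closure_subset by (intro zero) blast
          thus ?case using elim False by (simp add: f_def)
        qed
        thus ?thesis unfolding gx by (rule tendsto_eventually)
      qed
    qed
    have "(\<lambda>k. integral (UNIV - Z) (f k)) \<longlonglongrightarrow> integral (UNIV - Z) g"
      by (rule dominated_convergence(2)[OF intc(2) h _ conv]) (use bound in auto)
    hence "integral (UNIV - Z) g = 0"
      using intc(1) by (simp add: LIMSEQ_const_iff)
    moreover have "(g has_integral (\<Sum>T\<in>\<T>. area T *\<^sub>R (A T *v e))) UNIV"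
      unfolding g_def area_def
      using lmeasurable_iff_has_integral triangulation_lmeasurable[OF reg]
      by (intro has_integral_sum fin has_integral_scaleR_left) blast
    hence "(g has_integral (\<Sum>T\<in>\<T>. area T *\<^sub>R (A T *v e))) (UNIV - Z)"
      using has_integral_spike_set_eq[of UNIV "UNIV - Z" g] Z by (auto intro: negligible_subset)
    hence "integral (UNIV - Z) g = (\<Sum>T\<in>\<T>. area T *\<^sub>R (A T *v e))"
      by (rule integral_unique)
    ultimately show ?thesis by simp
  qed
  moreover have "(\<Sum>T\<in>\<T>. area T *\<^sub>R (A T *v e)) = (\<Sum>T\<in>\<T>. area T *\<^sub>R A T) *v e" for e
    using linear_sum[OF bounded_linear.linear[OF bounded_linear_matrix_apply[of e]], of "\<lambda>T. area T *\<^sub>R A T" \<T>]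
    by (simp add: scaleR_matrix_vector_assoc)
  ultimately have "(\<Sum>T\<in>\<T>. area T *\<^sub>R A T) *v e = 0 *v e" for e by simp
  thus ?thesis using matrix_eq by blast
qed

section \<open>Integrals of piecewise constant functions\<close>

lemma has_integral_piecewise_constant:
  fixes f :: "vec2 \<Rightarrow> 'b::euclidean_space"
  assumes reg: "regular_triangulation \<T>' S" and sub: "\<T> \<subseteq> \<T>'" and fin: "finite \<T>" and Z: "negligible Z"
    and on: "\<And>T x. T \<in> \<T> \<Longrightarrow> x \<in> interior T \<Longrightarrow> f x = c T"
    and off: "\<And>x. x \<notin> \<Union>\<T> \<Longrightarrow> x \<notin> Z \<Longrightarrow> f x = 0"
  shows "(f has_integral (\<Sum>T\<in>\<T>. area T *\<^sub>R c T)) UNIV"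
proof (rule has_integral_spike)
  show "negligible (Z \<union> (\<Union>T\<in>\<T>. frontier T))"
    using Z fin sub triangulation_convex[OF reg] negligible_convex_frontier
    by (intro negligible_Un negligible_Union) auto
  show "((\<lambda>x. \<Sum>T\<in>\<T>. indicat_real T x *\<^sub>R c T) has_integral (\<Sum>T\<in>\<T>. area T *\<^sub>R c T)) UNIV"
    unfolding area_def using lmeasurable_iff_has_integral triangulation_lmeasurable[OF reg] sub
    by (intro has_integral_sum fin has_integral_scaleR_left) blast
  fix x assume x: "x \<in> UNIV - (Z \<union> (\<Union>T\<in>\<T>. frontier T))"
  show "f x = (\<Sum>T\<in>\<T>. indicat_real T x *\<^sub>R c T)"
  proof (cases "x \<in> \<Union>\<T>")
    case False
    hence "(\<Sum>T\<in>\<T>. indicat_real T x *\<^sub>R c T) = 0" by (intro sum.neutral) auto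
    thus ?thesis using off[OF False] x by simp
  next
    case True
    then obtain T where T: "T \<in> \<T>" "x \<in> T" by blast
    hence xT: "x \<in> interior T" using x closure_subset by (fastforce simp: frontier_def)
    have "x \<notin> T'" if "T' \<in> \<T>" "T' \<noteq> T" for T'
      using triangulation_disjoint_interior[OF reg _ _ that(2)] that(1) T(1) sub xT by blast
    hence "(\<Sum>T'\<in>\<T>. indicat_real T' x *\<^sub>R c T') = (\<Sum>T'\<in>\<T>. if T' = T then c T else 0)"
      by (intro sum.cong) (use T in auto)
    thus ?thesis using on[OF T(1) xT] fin T(1) by simp
  qed
qed

section \<open>Periodic extension\<close>

lemma periods_add: "\<xi> \<in> periods \<Longrightarrow> \<eta> \<in> periods \<Longrightarrow> \<xi> + \<eta> \<in> periods"
proof -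
  assume "\<xi> \<in> periods" "\<eta> \<in> periods"
  then obtain m n :: "2 \<Rightarrow> int" where "\<And>i. \<xi>$i = 2 * of_int (m i)" "\<And>i. \<eta>$i = 2 * of_int (n i)"
    using period_even by metis
  thus ?thesis by (intro periodsI[of _ "\<lambda>i. m i + n i"]) simp
qed

definition nearest_period :: "vec2 \<Rightarrow> vec2" where
  "nearest_period x = (\<chi> i. 2 * of_int (round (x$i / 2)))"

lemma nearest_period: "nearest_period x \<in> periods"
  by (rule periodsI[of _ "\<lambda>i. round (x$i / 2)"]) (simp add: nearest_period_def)

lemma nearest_period_in_cell: "x - nearest_period x \<in> closure Omega"
  unfolding mem_closure_Omega
proof
  fix i
  have "\<bar>of_int (round (x$i / 2)) - x$i / 2\<bar> \<le> 1 / 2" by (rule of_int_round_abs_le)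
  hence "\<bar>x$i - 2 * of_int (round (x$i / 2))\<bar> \<le> 1" by linarith
  thus "\<bar>(x - nearest_period x)$i\<bar> \<le> 1" by (simp add: nearest_period_def)
qed

text \<open>On the boundary of a cell the nearest period is a matter of rounding, but there both candidates
  give the value 0.\<close>

lemma nearest_period_value:
  fixes w :: "vec2 \<Rightarrow> vec2"
  assumes zero: "\<And>x. x \<notin> interior Omega \<Longrightarrow> w x = 0"
    and \<xi>: "\<xi> \<in> periods" and x: "x - \<xi> \<in> closure Omega"
  shows "w (x - nearest_period x) = w (x - \<xi>)"
proof -
  obtain m :: "2 \<Rightarrow> int" where m: "\<And>i. \<xi>$i = 2 * of_int (m i)" using period_even[OF \<xi>] by blast
  show ?thesis
  proof (cases "x - \<xi> \<in> interior Omega")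
    case True
    have "nearest_period x $ i = \<xi>$i" for i
    proof -
      have "\<bar>x$i - 2 * of_int (m i)\<bar> < 1" using True by (simp add: mem_interior_Omega m)
      hence "\<bar>x$i / 2 - of_int (m i)\<bar> < 1 / 2" by linarith
      thus ?thesis using round_unique' by (simp add: nearest_period_def m)
    qed
    hence "nearest_period x = \<xi>" by (simp add: vec_eq_iff)
    thus ?thesis by simp
  next
    case False
    then obtain i where "\<not> \<bar>x$i - 2 * of_int (m i)\<bar> < 1" unfolding mem_interior_Omega by (auto simp: m)
    moreover have "\<bar>(x - \<xi>)$i\<bar> \<le> 1" using x mem_closure_Omega by blast
    ultimately have "\<bar>x$i - 2 * of_int (m i)\<bar> = 1" by (simp add: m)
    then obtain s :: int where s: "x$i = of_int (2 * m i + s)" "\<bar>s\<bar> = 1"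
      by (cases "x$i - 2 * of_int (m i) = 1") (auto simp: abs_if split: if_splits intro: that[of 1] that[of "-1"])
    define k where "k = round (x$i / 2)"
    have "(x - nearest_period x)$i = x$i - 2 * of_int k" by (simp add: nearest_period_def k_def)
    also have "\<dots> = of_int (2 * (m i - k) + s)" unfolding s(1) by simp
    finally have "(x - nearest_period x)$i = of_int (2 * (m i - k) + s)" .
    moreover have "2 * (m i - k) + s \<noteq> 0" using s(2) by presburger
    hence "\<bar>of_int (2 * (m i - k) + s) :: real\<bar> \<ge> 1" by linarith
    ultimately have "\<not> \<bar>(x - nearest_period x)$i\<bar> < 1" by simp
    hence "x - nearest_period x \<notin> interior Omega" unfolding mem_interior_Omega by blast
    thus ?thesis using zero False by simp
  qed
qed

lemma periodic_extension_continuous: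
  fixes w :: "vec2 \<Rightarrow> vec2"
  assumes cont: "continuous_on UNIV w" and zero: "\<And>x. x \<notin> interior Omega \<Longrightarrow> w x = 0"
  shows "continuous_on UNIV (\<lambda>x. w (x - nearest_period x))"
proof -
  have "isCont (\<lambda>x. w (x - nearest_period x)) x0" for x0
  proof -
    define K where "K = \<lceil>norm x0\<rceil> + 2"
    define I where "I = (\<lambda>(a, b). vector [2 * of_int a, 2 * of_int b] :: vec2) ` ({-K..K} \<times> {-K..K})"
    have per: "\<xi> \<in> periods" if \<xi>: "\<xi> \<in> I" for \<xi>
    proof -
      obtain a b :: int where "\<xi> = vector [2 * of_int a, 2 * of_int b]" using \<xi> by (auto simp: I_def)
      hence "\<xi>$i = 2 * of_int ((if i = 1 then a else b))" for i
        using exhaust_2[of i] by (auto simp: vector_2)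
      thus ?thesis by (rule periodsI)
    qed
    have "continuous_on (\<Union>\<xi>\<in>I. {x. x - \<xi> \<in> closure Omega}) (\<lambda>x. w (x - nearest_period x))"
    proof (rule continuous_on_closed_Union)
      show "finite I" by (simp add: I_def)
      show "closed {x. x - \<xi> \<in> closure Omega}" if "\<xi> \<in> I" for \<xi>
        using continuous_closed_vimage[of "closure Omega" "\<lambda>x. x - \<xi>"]
        by (auto simp: vimage_def intro!: continuous_intros)
      show "continuous_on {x. x - \<xi> \<in> closure Omega} (\<lambda>x. w (x - nearest_period x))" if "\<xi> \<in> I" for \<xi>
      proof -
        have "continuous_on {x. x - \<xi> \<in> closure Omega} (\<lambda>x. w (x - \<xi>))"
          by (rule continuous_on_compose2[OF cont]) (auto intro!: continuous_intros)
        moreover have "w (x - \<xi>) = w (x - nearest_period x)" if "x \<in> {x. x - \<xi> \<in> closure Omega}" for x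
          using nearest_period_value[OF _ per[OF \<open>\<xi> \<in> I\<close>], of w x] zero that by simp
        ultimately show ?thesis by (rule continuous_on_eq)
      qed
    qed
    moreover have "ball x0 1 \<subseteq> (\<Union>\<xi>\<in>I. {x. x - \<xi> \<in> closure Omega})"
    proof
      fix x assume x: "x \<in> ball x0 1"
      have nx: "norm x \<le> norm x0 + 1"
        using x norm_triangle_sub[of x x0] by (simp add: dist_norm norm_minus_commute)
      have K: "\<bar>round (x$i / 2)\<bar> \<le> K" for i
      proof -
        have "\<bar>of_int (round (x$i / 2)) :: real\<bar> \<le> of_int \<lceil>norm x0\<rceil> + 2"
          using of_int_round_abs_le[of "x$i / 2"] component_le_norm_cart[of x i] nx le_of_int_ceiling[of "norm x0"]
          by linarith
        thus ?thesis unfolding K_def by linarith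
      qed
      have "nearest_period x = vector [2 * of_int (round (x$1 / 2)), 2 * of_int (round (x$2 / 2))]"
        by (simp add: vec_eq_iff forall_2 vector_2 nearest_period_def)
      hence "nearest_period x \<in> I"
        unfolding I_def using K[of 1] K[of 2]
        by (intro image_eqI[of _ _ "(round (x$1 / 2), round (x$2 / 2))"]) (auto simp: abs_le_iff)
      thus "x \<in> (\<Union>\<xi>\<in>I. {x. x - \<xi> \<in> closure Omega})" using nearest_period_in_cell by blast
    qed
    ultimately have "continuous_on (ball x0 1) (\<lambda>x. w (x - nearest_period x))"
      by (rule continuous_on_subset)
    thus ?thesis by (simp add: continuous_on_eq_continuous_at)
  qed
  thus ?thesis by (simp add: continuous_at_imp_continuous_on)
qed

lemma periodic_extension_in_Uh:
  fixes w :: "vec2 \<Rightarrow> vec2"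
  assumes cover: "\<Union>Th = closure Omega"
    and aff: "\<And>T. T \<in> Th \<Longrightarrow> \<exists>A b. \<forall>x\<in>T. w x = A *v x + b"
    and cont: "continuous_on UNIV w" and zero: "\<And>x. x \<notin> interior Omega \<Longrightarrow> w x = 0"
  shows "(\<lambda>x. w (x - nearest_period x)) \<in> Uh N Th"
    and "\<And>x. x \<in> closure Omega \<Longrightarrow> w (x - nearest_period x) = w x"
proof -
  have val: "w (x - nearest_period x) = w (x - \<xi>)"
    if "\<xi> \<in> periods" "x - \<xi> \<in> closure Omega" for x \<xi>
    using nearest_period_value[OF _ that, of w] zero by blast
  show "w (x - nearest_period x) = w x" if "x \<in> closure Omega" for x
    using val[OF periods_zero, of x] that by simp
  have "\<exists>A b. \<forall>x\<in>T'. w (x - nearest_period x) = A *v x + b" if T': "T' \<in> mesh_per Th" for T'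
  proof -
    obtain \<xi> T where T: "\<xi> \<in> periods" "T \<in> Th" "T' = (\<lambda>x. \<xi> + x) ` T"
      using T' by (auto simp: mesh_per_def)
    obtain A b where Ab: "\<forall>x\<in>T. w x = A *v x + b" using aff[OF T(2)] by blast
    have "w (x - nearest_period x) = A *v x + (b - A *v \<xi>)" if "x \<in> T'" for x
    proof -
      have xT: "x - \<xi> \<in> T" using that T(3) by auto
      hence "w (x - nearest_period x) = w (x - \<xi>)" using cover T(2) by (intro val[OF T(1)]) blast
      thus ?thesis using Ab xT by (simp add: matrix_vector_mult_diff_distrib)
    qed
    thus ?thesis by blast
  qed
  moreover have "w ((\<xi> + x) - nearest_period (\<xi> + x)) = w (x - nearest_period x)" if "\<xi> \<in> periods" for \<xi> x
    using val[OF periods_add[OF that nearest_period[of x]], of "\<xi> + x"] nearest_period_in_cell[of x] by simp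
  ultimately show "(\<lambda>x. w (x - nearest_period x)) \<in> Uh N Th"
    using periodic_extension_continuous[OF cont zero] by (auto simp: Uh_def)
qed

section \<open>The patch test with a locally affine displacement\<close>

lemma FD_affine_perturbation:
  assumes "N \<ge> 1"
  shows "FD N r (\<lambda>x. F *v x + t *\<^sub>R u x) x = F *v r + t *\<^sub>R FD N r u x"
  using eps_pos[OF assms]
  by (simp add: FD_def matrix_vector_right_distrib matrix_vector_mult_scaleR algebra_simps)

lemma jacobian_affine_perturbation:
  assumes x: "x \<in> interior T" and u: "\<And>x. x \<in> T \<Longrightarrow> u x = A *v x + b"
  shows "jacobian (\<lambda>x. F *v x + t *\<^sub>R u x) x = F + t *\<^sub>R A"
proof -
  have lin: "((\<lambda>x. (F + t *\<^sub>R A) *v x + t *\<^sub>R b) has_derivative (\<lambda>h. (F + t *\<^sub>R A) *v h)) (at x)"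
    by (auto intro!: derivative_eq_intros bounded_linear_imp_has_derivative matrix_vector_mul_bounded_linear)
  have "((\<lambda>x. F *v x + t *\<^sub>R u x) has_derivative (\<lambda>h. (F + t *\<^sub>R A) *v h)) (at x)"
  proof (rule has_derivative_transform_within_open[OF lin open_interior x])
    fix y assume "y \<in> interior T"
    hence "u y = A *v y + b" using u interior_subset by blast
    thus "(F + t *\<^sub>R A) *v y + t *\<^sub>R b = F *v y + t *\<^sub>R u y"
      by (simp add: matrix_vector_mult_add_rdistrib scaleR_matrix_vector_assoc scaleR_add_right)
  qed
  hence "frechet_derivative (\<lambda>x. F *v x + t *\<^sub>R u x) (at x) = (\<lambda>h. (F + t *\<^sub>R A) *v h)"
    by (rule frechet_derivative_at[symmetric])
  thus ?thesis by (simp add: jacobian_def)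
qed

locale coupling =
  fixes N :: nat and d :: bool and R :: "vec2 set"
    and V :: "(vec2 \<Rightarrow> vec2) \<Rightarrow> real"
    and Ei :: "(vec2 \<times> vec2 \<Rightarrow> vec2) \<Rightarrow> real"
    and Th Ta Ti Tc :: "vec2 set set"
  assumes N: "N \<ge> 1"
    and R: "finite R" "R \<subseteq> Z2 - {0}"
    and V: "C1_fun R V"
    and Th: "finite Th" "regular_triangulation Th (closure Omega)"
    and partition: "Th = Ta \<union> Ti \<union> Tc" "Ta \<inter> Ti = {}" "Ta \<inter> Tc = {}" "Ti \<inter> Tc = {}"
    and Ei: "C1_fun (bonds_i N R Ti) Ei"
    and fine: "Ta \<union> Ti \<subseteq> Teps N d"
    and range_a: "\<And>x r. x \<in> sites_a N R Ta \<Longrightarrow> r \<in> R \<Longrightarrow>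
                    closed_segment x (x + eps N *\<^sub>R r) \<subseteq> \<Union>Ta \<union> \<Union>Ti"
    and nondegenerate: "no_bond_along_boundary N R Ta Ti"
    and compactly_inside: "\<Union>Ta \<union> \<Union>Ti \<subseteq> interior Omega"
begin

lemma finite_parts: "finite Ta" "finite Ti" "finite Tc"
  using Th(1) partition(1) by auto

lemma finite_sites: "finite (sites_a N R Ta)"
  by (rule finite_subset[OF _ finite_Lat[of N]]) (auto simp: sites_a_def)

lemma finite_bonds: "finite (bonds_i N R Ti)"
  by (rule finite_subset[of _ "Lat N \<times> R"]) (auto simp: bonds_i_def finite_Lat R(1))

text \<open>Interface bonds are only required to stay in the periodic copies of the interface region, but
  being connected they cannot change the copy.\<close>

lemma interface_bond_inside:
  assumes "(x, r) \<in> bonds_i N R Ti"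
  shows "closed_segment x (x + eps N *\<^sub>R r) \<subseteq> \<Union>Ti"
proof (rule connected_within_cell)
  show "closed_segment x (x + eps N *\<^sub>R r) \<subseteq> per (\<Union>Ti)" using assms by (auto simp: bonds_i_def)
  show "\<Union>Ti \<subseteq> interior Omega" using compactly_inside by blast
  show "x \<in> Omega" using assms Lat_subset_Omega[OF N] by (auto simp: bonds_i_def)
qed auto

text \<open>The test displacement equals G x on the atomistic and interface regions, where all bonds of the
  discrete energies lie.  On the continuum region its individual gradients are unknown, but as the
  stress there is constant only their integral enters, and this is minus the integral of G over the
  other two regions because the mean gradient vanishes.\<close>

lemma patch_test_balance_inner:
  assumes patch: "patch_test_consistent N Th (E_ac N R V Ei Ta Tc)"
  shows "(\<Sum>T\<in>Ta \<union> Ti. area T) * (G \<bullet> dW V F) =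
     (eps N)\<^sup>2 * (\<Sum>x\<in>sites_a N R Ta. \<Sum>r\<in>R. (G *v r) \<bullet> pgrad r V (\<lambda>r. F *v r)) +
     (eps N)\<^sup>2 * (\<Sum>b\<in>bonds_i N R Ti. (G *v snd b) \<bullet> pgrad b Ei (\<lambda>b. F *v snd b))"
proof -
  have cover: "\<Union>Th = closure Omega" using Th(2) by (simp add: regular_triangulation_def)
  obtain w where aff: "\<And>T. T \<in> Th \<Longrightarrow> \<exists>A b. \<forall>x\<in>T. w x = A *v x + b"
    and zero: "\<And>x. x \<notin> interior Omega \<Longrightarrow> w x = 0"
    and inner: "\<And>T x. T \<in> Th \<Longrightarrow> T \<subseteq> interior Omega \<Longrightarrow> x \<in> T \<Longrightarrow> w x = G *v x"
    using cut_off_linear_field[OF Th(2), of G] by blast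
  obtain M where lip: "M-lipschitz_on UNIV w"
    using piecewise_affine_lipschitz[OF Th(1) triangulation_closed[OF Th(2)] cover aff zero] by blast
  define u where "u = (\<lambda>x. w (x - nearest_period x))"
  have uU: "u \<in> Uh N Th" and uw: "\<And>x. x \<in> closure Omega \<Longrightarrow> u x = w x"
    unfolding u_def
    using periodic_extension_in_Uh[OF cover aff lipschitz_on_continuous_on[OF lip] zero] by blast+
  have inside: "interior Omega \<subseteq> closure Omega" using interior_subset closure_subset by blast
  have uG: "u x = G *v x" if x: "x \<in> \<Union>Ta \<union> \<Union>Ti" for x
  proof -
    obtain T where T: "T \<in> Ta \<union> Ti" "x \<in> T" using x by blast
    hence "T \<in> Th" "T \<subseteq> interior Omega" using partition(1) compactly_inside by auto
    hence "w x = G *v x" using inner T(2) by blast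
    moreover have "x \<in> closure Omega" using x compactly_inside inside by blast
    ultimately show ?thesis using uw by simp
  qed
  obtain A0 b0 where A0: "\<And>T x. T \<in> Th \<Longrightarrow> x \<in> T \<Longrightarrow> w x = A0 T *v x + b0 T"
    using aff by metis
  define A where "A = (\<lambda>T. if T \<in> Ta \<union> Ti then G else A0 T)"
  define b where "b = (\<lambda>T. if T \<in> Ta \<union> Ti then 0 else b0 T)"
  have Ab: "w x = A T *v x + b T" if "T \<in> Th" "x \<in> T" for T x
  proof (cases "T \<in> Ta \<union> Ti")
    case True
    hence "T \<subseteq> interior Omega" using compactly_inside by blast
    thus ?thesis using True inner that by (simp add: A_def b_def)
  qed (use A0 that in \<open>simp add: A_def b_def\<close>)
  have "(\<Sum>T\<in>Th. area T *\<^sub>R A T) = 0"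
    by (rule piecewise_affine_mean_gradient_0[OF Th(2,1) lip Ab zero])
  also have "(\<Sum>T\<in>Th. area T *\<^sub>R A T) = (\<Sum>T\<in>Ta \<union> Ti. area T *\<^sub>R A T) + (\<Sum>T\<in>Tc. area T *\<^sub>R A T)"
    using partition finite_parts by (subst partition(1), intro sum.union_disjoint) auto
  also have "(\<Sum>T\<in>Ta \<union> Ti. area T *\<^sub>R A T) = (\<Sum>T\<in>Ta \<union> Ti. area T) *\<^sub>R G"
    by (simp add: A_def scaleR_left.sum)
  finally have mean: "(\<Sum>T\<in>Tc. area T *\<^sub>R A T) = - ((\<Sum>T\<in>Ta \<union> Ti. area T) *\<^sub>R G)"
    by (simp add: eq_neg_iff_add_eq_0 add.commute)

  have bulk: "integral (\<Union>Tc) (\<lambda>x. W V (jacobian (\<lambda>x. F *v x + t *\<^sub>R u x) x))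
      = (\<Sum>T\<in>Tc. area T * W V (F + t *\<^sub>R A T))" for t
  proof -
    have "((\<lambda>x. if x \<in> \<Union>Tc then W V (jacobian (\<lambda>x. F *v x + t *\<^sub>R u x) x) else 0)
        has_integral (\<Sum>T\<in>Tc. area T *\<^sub>R W V (F + t *\<^sub>R A T))) UNIV"
    proof (rule has_integral_piecewise_constant[OF Th(2) _ finite_parts(3) negligible_empty])
      fix T x assume T: "T \<in> Tc" and x: "x \<in> interior T"
      have TTh: "T \<in> Th" using T partition(1) by blast
      have "u y = A T *v y + b T" if "y \<in> T" for y
      proof -
        have "y \<in> closure Omega" using that TTh cover by blast
        thus ?thesis using uw Ab[OF TTh that] by simp
      qed
      hence "jacobian (\<lambda>x. F *v x + t *\<^sub>R u x) x = F + t *\<^sub>R A T"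
        by (rule jacobian_affine_perturbation[OF x])
      thus "(if x \<in> \<Union>Tc then W V (jacobian (\<lambda>x. F *v x + t *\<^sub>R u x) x) else 0) = W V (F + t *\<^sub>R A T)"
        using T x interior_subset by auto
    qed (use partition in auto)
    hence "((\<lambda>x. W V (jacobian (\<lambda>x. F *v x + t *\<^sub>R u x) x))
        has_integral (\<Sum>T\<in>Tc. area T *\<^sub>R W V (F + t *\<^sub>R A T))) (\<Union>Tc)"
      by (simp only: has_integral_restrict_UNIV)
    thus ?thesis by (simp add: integral_unique)
  qed
  have E: "E_ac N R V Ei Ta Tc (\<lambda>x. yhom F x + t *\<^sub>R u x) =
      (\<Sum>T\<in>Tc. area T * W V (F + t *\<^sub>R A T))
      + (eps N)\<^sup>2 * (\<Sum>x\<in>sites_a N R Ta. V (\<lambda>r. F *v r + t *\<^sub>R FD N r u x))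
      + (eps N)\<^sup>2 * Ei (\<lambda>b. F *v snd b + t *\<^sub>R FD N (snd b) u (fst b))" for t
    unfolding E_ac_def yhom_def bulk
    by (simp add: stencil_def bond_diffs_def case_prod_unfold FD_affine_perturbation[OF N])
  have FD: "FD N r u x = G *v r" if "closed_segment x (x + eps N *\<^sub>R r) \<subseteq> \<Union>Ta \<union> \<Union>Ti" for x r
  proof -
    have "u x = G *v x" "u (x + eps N *\<^sub>R r) = G *v (x + eps N *\<^sub>R r)"
      using that by (auto intro!: uG)
    thus ?thesis
      using eps_pos[OF N] by (simp add: FD_def matrix_vector_right_distrib matrix_vector_mult_scaleR)
  qed
  have dbulk: "((\<lambda>t. \<Sum>T\<in>Tc. area T * W V (F + t *\<^sub>R A T)) has_real_derivative
      (\<Sum>T\<in>Tc. area T * (A T \<bullet> dW V F))) (at 0)"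
    by (intro DERIV_sum DERIV_cmult W_line_derivative[OF V R(1)])
  have dsites: "((\<lambda>t. \<Sum>x\<in>sites_a N R Ta. V (\<lambda>r. F *v r + t *\<^sub>R FD N r u x)) has_real_derivative
      (\<Sum>x\<in>sites_a N R Ta. \<Sum>r\<in>R. (G *v r) \<bullet> pgrad r V (\<lambda>r. F *v r))) (at 0)"
    by (intro DERIV_sum C1_fun_line_derivative[OF V R(1)] FD range_a)
  have dbonds: "((\<lambda>t. Ei (\<lambda>b. F *v snd b + t *\<^sub>R FD N (snd b) u (fst b))) has_real_derivative
      (\<Sum>b\<in>bonds_i N R Ti. (G *v snd b) \<bullet> pgrad b Ei (\<lambda>b. F *v snd b))) (at 0)"
  proof (rule C1_fun_line_derivative[OF Ei finite_bonds])
    fix b assume "b \<in> bonds_i N R Ti"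
    thus "FD N (snd b) u (fst b) = G *v snd b"
      using interface_bond_inside[of "fst b" "snd b"] by (intro FD) auto
  qed
  have "((\<lambda>t. E_ac N R V Ei Ta Tc (\<lambda>x. yhom F x + t *\<^sub>R u x)) has_real_derivative
      (\<Sum>T\<in>Tc. area T * (A T \<bullet> dW V F))
      + (eps N)\<^sup>2 * (\<Sum>x\<in>sites_a N R Ta. \<Sum>r\<in>R. (G *v r) \<bullet> pgrad r V (\<lambda>r. F *v r))
      + (eps N)\<^sup>2 * (\<Sum>b\<in>bonds_i N R Ti. (G *v snd b) \<bullet> pgrad b Ei (\<lambda>b. F *v snd b))) (at 0)"
    unfolding E by (intro DERIV_add DERIV_cmult dbulk dsites dbonds)
  hence "first_variation (E_ac N R V Ei Ta Tc) (yhom F) u =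
      (\<Sum>T\<in>Tc. area T * (A T \<bullet> dW V F))
      + (eps N)\<^sup>2 * (\<Sum>x\<in>sites_a N R Ta. \<Sum>r\<in>R. (G *v r) \<bullet> pgrad r V (\<lambda>r. F *v r))
      + (eps N)\<^sup>2 * (\<Sum>b\<in>bonds_i N R Ti. (G *v snd b) \<bullet> pgrad b Ei (\<lambda>b. F *v snd b))"
    unfolding first_variation_def by (rule DERIV_imp_deriv)
  moreover have "first_variation (E_ac N R V Ei Ta Tc) (yhom F) u = 0"
    using patch uU by (simp add: patch_test_consistent_def)
  moreover have "(\<Sum>T\<in>Tc. area T * (A T \<bullet> dW V F)) = (\<Sum>T\<in>Tc. area T *\<^sub>R A T) \<bullet> dW V F"
    by (simp add: inner_sum_left)
  ultimately show ?thesis unfolding mean by simp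
qed

lemma patch_test_balance:
  assumes patch: "patch_test_consistent N Th (E_ac N R V Ei Ta Tc)"
  shows "(\<Sum>T\<in>Ta \<union> Ti. area T) *\<^sub>R dW V F =
     (eps N)\<^sup>2 *\<^sub>R (\<Sum>x\<in>sites_a N R Ta. \<Sum>r\<in>R. tensor (pgrad r V (\<lambda>r. F *v r)) r) +
     (eps N)\<^sup>2 *\<^sub>R (\<Sum>b\<in>bonds_i N R Ti. tensor (pgrad b Ei (\<lambda>b. F *v snd b)) (snd b))"
  (is "?l = ?r")
proof -
  have "G \<bullet> ?l = G \<bullet> ?r" for G
    using patch_test_balance_inner[OF patch, of G F]
    by (simp add: inner_add_right inner_sum_right inner_tensor del: sum_constant)
  hence "(?l - ?r) \<bullet> (?l - ?r) = 0" by (simp add: inner_diff_right)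
  thus ?thesis by simp
qed

end

section \<open>The mean of the stress function\<close>

text \<open>This reduces the sums over infinitely many periodic bonds in the stress to the bonds that occur
  in the energy.\<close>

lemma translated_segment_misses_cell:
  assumes seg: "closed_segment x x' \<subseteq> interior Omega" and \<xi>: "\<xi> \<in> periods" "\<xi> \<noteq> 0"
  shows "closed_segment (\<xi> + x) (\<xi> + x') \<inter> closure Omega = {}"
proof -
  have "\<xi> = 0" if y: "y \<in> closed_segment (\<xi> + x) (\<xi> + x')" "y \<in> closure Omega" for y
  proof -
    obtain z where "z \<in> closed_segment x x'" "y = \<xi> + z"
      using y(1) unfolding closed_segment_translation by blast
    thus ?thesis using closure_interior_Omega_period_eq_0[OF \<xi>(1), of z] seg y(2) by blast
  qed
  thus ?thesis using \<xi>(2) by blast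
qed

lemma finite_extreme_points_simplex:
  assumes "n simplex T" shows "finite {v. v extreme_point_of T}"
proof -
  obtain C where C: "finite C" "T = convex hull C" using assms by (auto simp: simplex)
  have "{v. v extreme_point_of T} \<subseteq> C"
    unfolding C(2) using extreme_point_of_convex_hull by blast
  thus ?thesis using C(1) by (rule finite_subset)
qed

text \<open>An affine representation determines its matrix, since this is the derivative at an interior
  point.\<close>

lemma grad_on_yhom:
  assumes "interior T \<noteq> {}" shows "grad_on (yhom F) T = F"
  unfolding grad_on_def
proof (rule the_equality)
  show "\<exists>b. \<forall>x\<in>T. yhom F x = F *v x + b" by (rule exI[of _ 0]) (simp add: yhom_def)
next
  fix A assume "\<exists>b. \<forall>x\<in>T. yhom F x = A *v x + b"
  then obtain b where b: "\<And>x. x \<in> T \<Longrightarrow> yhom F x = A *v x + b" by blast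
  obtain x where x: "x \<in> interior T" using assms by blast
  have F0: "yhom F x = F *v x + 0" for x by (simp add: yhom_def)
  have "0 + 1 *\<^sub>R A = 0 + 1 *\<^sub>R F"
    using jacobian_affine_perturbation[OF x b, of 0 1] jacobian_affine_perturbation[OF x F0, of 0 1]
    by simp
  thus "A = F" by simp
qed

context coupling
begin

abbreviation site_stress :: "mat2 \<Rightarrow> vec2 \<Rightarrow> mat2" where
  "site_stress F r \<equiv> tensor (pgrad r V (\<lambda>r. F *v r)) r"

abbreviation bond_stress :: "mat2 \<Rightarrow> vec2 \<times> vec2 \<Rightarrow> mat2" where
  "bond_stress F b \<equiv> tensor (pgrad b Ei (\<lambda>b. F *v snd b)) (snd b)"

abbreviation stress_value :: "mat2 \<Rightarrow> vec2 set \<Rightarrow> mat2" where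
  "stress_value F \<equiv> stress_on N R V Ei Ta Ti Tc (yhom F)"

lemma FD_yhom: "FD N r (yhom F) x = F *v r"
  using FD_affine_perturbation[OF N, of r F 0 "\<lambda>_. 0" x] by (simp add: yhom_def)

lemma stencil_yhom: "stencil N (yhom F) x = (\<lambda>r. F *v r)"
  by (simp add: stencil_def FD_yhom)

lemma dEi_yhom:
  assumes "(x, r) \<in> bonds_i N R Ti"
  shows "dEi N Ei (yhom F) (x, r) = pgrad (x, r) Ei (\<lambda>b. F *v snd b)"
proof -
  have "bond_diffs N (yhom F) = (\<lambda>b. F *v snd b)"
    by (auto simp: bond_diffs_def FD_yhom)
  moreover have "x \<in> Lat N" using assms by (simp add: bonds_i_def)
  ultimately show ?thesis by (simp add: dEi_def Lat_representative[OF N])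
qed

lemma inner_triangle:
  assumes "T \<in> Ta \<union> Ti"
  shows "T \<in> Th" "T \<subseteq> interior Omega" "T \<subseteq> closure Omega" "convex T" "closed T" "area T > 0"
proof -
  show T: "T \<in> Th" using assms partition(1) by blast
  show sub: "T \<subseteq> interior Omega" using assms compactly_inside by blast
  show "T \<subseteq> closure Omega" using sub interior_subset closure_subset by blast
  show "convex T" "closed T" using triangulation_convex[OF Th(2) T] triangulation_closed[OF Th(2) T] .
  have "\<not> negligible T"
    using triangulation_interior[OF Th(2) T] open_not_negligible[OF open_interior]
      negligible_subset[OF _ interior_subset] by blast
  hence "measure lebesgue T \<noteq> 0"
    using triangulation_lmeasurable[OF Th(2) T] negligible_iff_measure by blast
  thus "area T > 0" unfolding area_def using measure_nonneg[of lebesgue T] by linarith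
qed

lemma translated_site_bond:
  assumes "x \<in> sites_a N R Ta" "r \<in> R" "\<xi> \<in> periods" "\<xi> \<noteq> 0" "T \<in> Ta \<union> Ti"
  shows "closed_segment (\<xi> + x) (\<xi> + x + eps N *\<^sub>R r) \<inter> T = {}"
proof -
  have "closed_segment x (x + eps N *\<^sub>R r) \<subseteq> interior Omega"
    using range_a[OF assms(1,2)] compactly_inside by blast
  from translated_segment_misses_cell[OF this assms(3,4)] inner_triangle(3)[OF assms(5)]
  show ?thesis by (auto simp: add.assoc)
qed

text \<open>If the bond met the triangle, its representative in the cell would start at a site of the
  atomistic energy, whose bonds stay inside the open cell; then no translation can have taken place.\<close>

lemma bond_of_other_site:
  assumes x: "x \<in> Lat_per N" "x \<notin> sites_a N R Ta" and r: "r \<in> R" and T: "T \<in> Ta"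
  shows "closed_segment x (x + eps N *\<^sub>R r) \<inter> T = {}"
proof (rule ccontr)
  assume "\<not> ?thesis"
  then obtain y where y: "y \<in> closed_segment x (x + eps N *\<^sub>R r)" "y \<in> T" by blast
  obtain \<xi> x0 where x0: "\<xi> \<in> periods" "x0 \<in> Lat N" "x = \<xi> + x0"
    using Lat_per_subset[OF N] x(1) by (auto simp: per_def)
  obtain z where z: "z \<in> closed_segment x0 (x0 + eps N *\<^sub>R r)" "y = \<xi> + z"
    using y(1) closed_segment_translation[of \<xi> x0 "x0 + eps N *\<^sub>R r"] unfolding x0(3) add.assoc by blast
  obtain m :: "2 \<Rightarrow> int" where m: "\<And>i. \<xi>$i = 2 * of_int (m i)" using period_even[OF x0(1)] by blast
  have "- \<xi> \<in> periods" by (rule periodsI[of _ "\<lambda>i. - m i"]) (simp add: m)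
  moreover have "z = - \<xi> + y" using z(2) by simp
  ultimately have "z \<in> per (\<Union>Ta)" using y(2) T unfolding per_def by blast
  hence site: "x0 \<in> sites_a N R Ta" using x0(2) r z(1) by (auto simp: sites_a_def)
  show False
  proof (cases "\<xi> = 0")
    case True thus False using site x(2) x0(3) by simp
  next
    case False
    thus False using translated_site_bond[OF site r x0(1) False, of T] T y unfolding x0(3) by blast
  qed
qed

lemma infsum_atomistic:
  assumes T: "T \<in> Ta" and r: "r \<in> R"
  shows "(\<Sum>\<^sub>\<infinity>x\<in>Lat_per N. bond_avg (chi T) x (x + eps N *\<^sub>R r) *\<^sub>R C) =
    (\<Sum>x\<in>sites_a N R Ta. bond_avg (chi T) x (x + eps N *\<^sub>R r) *\<^sub>R (C :: mat2))"
proof -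
  have "(\<Sum>\<^sub>\<infinity>x\<in>Lat_per N. bond_avg (chi T) x (x + eps N *\<^sub>R r) *\<^sub>R C) =
     (\<Sum>\<^sub>\<infinity>x\<in>sites_a N R Ta. bond_avg (chi T) x (x + eps N *\<^sub>R r) *\<^sub>R C)"
  proof (rule infsum_cong_neutral)
    fix x assume x: "x \<in> Lat_per N - sites_a N R Ta"
    have "bond_avg (chi T) x (x + eps N *\<^sub>R r) = 0"
    proof (rule bond_avg_eq_0, rule chi_outside)
      show "closed T" using inner_triangle T by blast
      show "y \<notin> T" if "y \<in> closed_segment x (x + eps N *\<^sub>R r)" for y
        using bond_of_other_site[OF _ _ r T, of x] x that by blast
    qed
    thus "bond_avg (chi T) x (x + eps N *\<^sub>R r) *\<^sub>R C = 0" by simp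
  next
    fix x assume "x \<in> sites_a N R Ta - Lat_per N"
    thus "bond_avg (chi T) x (x + eps N *\<^sub>R r) *\<^sub>R C = 0"
      using Lat_subset_Lat_per by (auto simp: sites_a_def)
  qed simp
  thus ?thesis using finite_sites by simp
qed

lemma infsum_interface_sites:
  assumes T: "T \<in> Ti" and r: "r \<in> R"
  shows "(\<Sum>\<^sub>\<infinity>x\<in>per (sites_a N R Ta). bond_avg (chi T) x (x + eps N *\<^sub>R r) *\<^sub>R C) =
    (\<Sum>x\<in>sites_a N R Ta. bond_avg (chi T) x (x + eps N *\<^sub>R r) *\<^sub>R (C :: mat2))"
proof -
  have "(\<Sum>\<^sub>\<infinity>x\<in>per (sites_a N R Ta). bond_avg (chi T) x (x + eps N *\<^sub>R r) *\<^sub>R C) =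
     (\<Sum>\<^sub>\<infinity>x\<in>sites_a N R Ta. bond_avg (chi T) x (x + eps N *\<^sub>R r) *\<^sub>R C)"
  proof (rule infsum_cong_neutral)
    fix x assume x: "x \<in> per (sites_a N R Ta) - sites_a N R Ta"
    then obtain \<xi> x0 where x0: "\<xi> \<in> periods" "x0 \<in> sites_a N R Ta" "x = \<xi> + x0"
      by (auto simp: per_def)
    hence "\<xi> \<noteq> 0" using x by auto
    have "bond_avg (chi T) x (x + eps N *\<^sub>R r) = 0"
    proof (rule bond_avg_eq_0, rule chi_outside)
      show "closed T" using inner_triangle T by blast
      show "y \<notin> T" if "y \<in> closed_segment x (x + eps N *\<^sub>R r)" for y
        using translated_site_bond[OF x0(2) r x0(1) \<open>\<xi> \<noteq> 0\<close>, of T] T that unfolding x0(3) by blast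
    qed
    thus "bond_avg (chi T) x (x + eps N *\<^sub>R r) *\<^sub>R C = 0" by simp
  next
    fix x assume "x \<in> sites_a N R Ta - per (sites_a N R Ta)"
    thus "bond_avg (chi T) x (x + eps N *\<^sub>R r) *\<^sub>R C = 0"
      using subset_per by blast
  qed simp
  thus ?thesis using finite_sites by simp
qed

lemma infsum_interface_bonds:
  assumes T: "T \<in> Ti"
  shows "(\<Sum>\<^sub>\<infinity>(x, r)\<in>bonds_i_per N R Ti.
       bond_avg (chi_i Ti T) x (x + eps N *\<^sub>R r) *\<^sub>R tensor (dEi N Ei (yhom F) (x, r)) r) =
    (\<Sum>b\<in>bonds_i N R Ti. bond_avg (chi_i Ti T) (fst b) (fst b + eps N *\<^sub>R snd b) *\<^sub>R bond_stress F b)"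
proof -
  have "(\<Sum>\<^sub>\<infinity>(x, r)\<in>bonds_i_per N R Ti.
       bond_avg (chi_i Ti T) x (x + eps N *\<^sub>R r) *\<^sub>R tensor (dEi N Ei (yhom F) (x, r)) r) =
    (\<Sum>\<^sub>\<infinity>b\<in>bonds_i N R Ti. bond_avg (chi_i Ti T) (fst b) (fst b + eps N *\<^sub>R snd b) *\<^sub>R bond_stress F b)"
  proof (rule infsum_cong_neutral)
    fix b assume b: "b \<in> bonds_i_per N R Ti - bonds_i N R Ti"
    then obtain \<xi> x r where x: "\<xi> \<in> periods" "(x, r) \<in> bonds_i N R Ti" "b = (\<xi> + x, r)"
      by (auto simp: bonds_i_per_def)
    hence "\<xi> \<noteq> 0" using b by auto
    have seg: "closed_segment x (x + eps N *\<^sub>R r) \<subseteq> interior Omega"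
      using interface_bond_inside[OF x(2)] compactly_inside by blast
    have "bond_avg (chi_i Ti T) (\<xi> + x) (\<xi> + x + eps N *\<^sub>R r) = 0"
    proof (rule bond_avg_eq_0, rule chi_i_outside)
      show "closed T" using inner_triangle T by blast
      show "y \<notin> T" if "y \<in> closed_segment (\<xi> + x) (\<xi> + x + eps N *\<^sub>R r)" for y
        using translated_segment_misses_cell[OF seg x(1) \<open>\<xi> \<noteq> 0\<close>] inner_triangle(3)[of T] T that
        by (auto simp: add.assoc)
    qed
    thus "(case b of (x, r) \<Rightarrow> bond_avg (chi_i Ti T) x (x + eps N *\<^sub>R r) *\<^sub>R tensor (dEi N Ei (yhom F) (x, r)) r) = 0"
      by (simp add: x(3))
  next
    fix b assume "b \<in> bonds_i N R Ti - bonds_i_per N R Ti"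
    moreover have "bonds_i N R Ti \<subseteq> bonds_i_per N R Ti"
      using periods_zero by (force simp: bonds_i_per_def)
    ultimately show "bond_avg (chi_i Ti T) (fst b) (fst b + eps N *\<^sub>R snd b) *\<^sub>R bond_stress F b = 0"
      by blast
  next
    fix b assume "b \<in> bonds_i_per N R Ti \<inter> bonds_i N R Ti"
    thus "(case b of (x, r) \<Rightarrow> bond_avg (chi_i Ti T) x (x + eps N *\<^sub>R r) *\<^sub>R tensor (dEi N Ei (yhom F) (x, r)) r) =
       bond_avg (chi_i Ti T) (fst b) (fst b + eps N *\<^sub>R snd b) *\<^sub>R bond_stress F b"
      by (cases b) (simp add: dEi_yhom)
  qed
  thus ?thesis using finite_bonds by simp
qed

lemma interface_triangle_separate:
  assumes "T \<in> Ti"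
  shows "\<not> T \<subseteq> \<Union>Ta" "\<not> T \<subseteq> \<Union>Tc"
proof -
  have T: "T \<in> Th" using assms partition(1) by blast
  have sep: "\<not> T \<subseteq> \<Union>\<T>" if "\<T> \<subseteq> Th" "T \<notin> \<T>" for \<T>
  proof -
    obtain x where x: "x \<in> interior T" using triangulation_interior[OF Th(2) T] by blast
    have "x \<notin> \<Union>\<T>"
      using triangulation_disjoint_interior[OF Th(2) _ T] that x by blast
    thus ?thesis using x interior_subset by blast
  qed
  show "\<not> T \<subseteq> \<Union>Ta" "\<not> T \<subseteq> \<Union>Tc"
    using sep[of Ta] sep[of Tc] partition assms by auto
qed

lemma stress_value_atomistic:
  assumes "T \<in> Ta"
  shows "area T *\<^sub>R stress_value F T = (eps N)\<^sup>2 *\<^sub>R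
    (\<Sum>r\<in>R. \<Sum>x\<in>sites_a N R Ta. bond_avg (chi T) x (x + eps N *\<^sub>R r) *\<^sub>R site_stress F r)"
proof -
  have "T \<subseteq> \<Union>Ta" using assms by blast
  hence "stress_value F T = (\<Sum>r\<in>R. ((eps N)\<^sup>2 / area T) *\<^sub>R
      (\<Sum>x\<in>sites_a N R Ta. bond_avg (chi T) x (x + eps N *\<^sub>R r) *\<^sub>R site_stress F r))"
    using infsum_atomistic[OF assms] by (simp add: stress_on_def stencil_yhom)
  thus ?thesis using inner_triangle(6)[of T] assms by (simp add: scaleR_sum_right)
qed

lemma stress_value_interface:
  assumes "T \<in> Ti"
  shows "area T *\<^sub>R stress_value F T = (eps N)\<^sup>2 *\<^sub>R
      (\<Sum>r\<in>R. \<Sum>x\<in>sites_a N R Ta. bond_avg (chi T) x (x + eps N *\<^sub>R r) *\<^sub>R site_stress F r)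
    + (eps N)\<^sup>2 *\<^sub>R (\<Sum>b\<in>bonds_i N R Ti.
        bond_avg (chi_i Ti T) (fst b) (fst b + eps N *\<^sub>R snd b) *\<^sub>R bond_stress F b)"
proof -
  have "T \<subseteq> \<Union>Ti" using assms by blast
  hence "stress_value F T = (\<Sum>r\<in>R. ((eps N)\<^sup>2 / area T) *\<^sub>R
      (\<Sum>x\<in>sites_a N R Ta. bond_avg (chi T) x (x + eps N *\<^sub>R r) *\<^sub>R site_stress F r))
    + ((eps N)\<^sup>2 / area T) *\<^sub>R (\<Sum>b\<in>bonds_i N R Ti.
        bond_avg (chi_i Ti T) (fst b) (fst b + eps N *\<^sub>R snd b) *\<^sub>R bond_stress F b)"
    using infsum_interface_sites[OF assms] infsum_interface_bonds[OF assms] interface_triangle_separate[OF assms]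
    by (simp add: stress_on_def stencil_yhom)
  thus ?thesis using inner_triangle(6)[of T] assms
    by (simp add: scaleR_sum_right scaleR_add_right)
qed

lemma bond_nondegenerate: "r \<in> R \<Longrightarrow> x \<noteq> x + eps N *\<^sub>R r"
  using R(2) eps_pos[OF N] by auto

text \<open>The bond may touch the boundary of the discrete regions, where the densities need not add up to
  one, but only at finitely many points.\<close>

lemma sum_bond_avg_site:
  assumes "x \<in> sites_a N R Ta" "r \<in> R"
  shows "(\<Sum>T\<in>Ta \<union> Ti. bond_avg (chi T) x (x + eps N *\<^sub>R r)) = 1"
proof (rule sum_bond_avg_eq_1)
  show "finite (Ta \<union> Ti)" using finite_parts by simp
  show "chi T \<in> borel_measurable borel" "\<bar>chi T y\<bar> \<le> 1" if "T \<in> Ta \<union> Ti" for T y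
    using chi_borel_measurable chi_bounds inner_triangle(4,5)[OF that] by auto
  show "x \<noteq> x + eps N *\<^sub>R r" by (rule bond_nondegenerate[OF assms(2)])
  show "finite (closed_segment x (x + eps N *\<^sub>R r) \<inter> frontier (\<Union>Ta \<union> \<Union>Ti))"
    using nondegenerate assms by (simp add: no_bond_along_boundary_def)
  fix y assume y: "y \<in> closed_segment x (x + eps N *\<^sub>R r)" "y \<notin> frontier (\<Union>Ta \<union> \<Union>Ti)"
  have "y \<in> \<Union>Ta \<union> \<Union>Ti" using range_a[OF assms] y(1) by blast
  hence "y \<in> interior (\<Union>(Ta \<union> Ti))"
    using y(2) closure_subset[of "\<Union>Ta \<union> \<Union>Ti"] by (auto simp: frontier_def)
  thus "(\<Sum>T\<in>Ta \<union> Ti. chi T y) = 1"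
    using inner_triangle(4,5) finite_parts pairwise_subset[OF triangulation_negligible_overlap[OF Th(2)]]
      partition(1) by (intro sum_chi_eq_1) auto
qed

text \<open>A point on the boundary of the interface region that is no corner lies in one triangle only,
  since two triangles would surround it.  This triangle receives the whole weight, where the
  density would only give it one half.\<close>

lemma sum_bond_avg_interface:
  assumes b: "b \<in> bonds_i N R Ti"
  shows "(\<Sum>T\<in>Ti. bond_avg (chi_i Ti T) (fst b) (fst b + eps N *\<^sub>R snd b)) = 1"
proof (rule sum_bond_avg_eq_1)
  define E where "E = (\<Union>T\<in>Ti. {v. v extreme_point_of T})"
  show "finite Ti" by (rule finite_parts)
  show "chi_i Ti T \<in> borel_measurable borel" "\<bar>chi_i Ti T y\<bar> \<le> 1" if "T \<in> Ti" for T y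
    using chi_i_borel_measurable chi_i_bounds inner_triangle(4,5)[of T] that by auto
  have "snd b \<in> R" using b by (auto simp: bonds_i_def)
  thus "fst b \<noteq> fst b + eps N *\<^sub>R snd b" by (rule bond_nondegenerate)
  have "finite E"
    unfolding E_def using finite_parts(2) finite_extreme_points_simplex triangulation_simplex[OF Th(2)] partition(1)
    by blast
  thus "finite (closed_segment (fst b) (fst b + eps N *\<^sub>R snd b) \<inter> E)" by blast
  fix y assume y: "y \<in> closed_segment (fst b) (fst b + eps N *\<^sub>R snd b)" "y \<notin> E"
  have yTi: "y \<in> \<Union>Ti" using interface_bond_inside[of "fst b" "snd b"] b y(1) by auto
  show "(\<Sum>T\<in>Ti. chi_i Ti T y) = 1"
  proof (cases "y \<in> interior (\<Union>Ti)")
    case True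
    have "y \<in> interior (per (\<Union>Ti))" using True interior_mono[OF subset_per] by blast
    hence "y \<notin> frontier (per (\<Union>Ti))" by (simp add: frontier_def)
    hence "(\<Sum>T\<in>Ti. chi_i Ti T y) = (\<Sum>T\<in>Ti. chi T y)" by (simp add: chi_i_def)
    also have "\<dots> = 1"
      using inner_triangle(4,5) finite_parts pairwise_subset[OF triangulation_negligible_overlap[OF Th(2)]]
        partition(1) True by (intro sum_chi_eq_1) auto
    finally show ?thesis .
  next
    case False
    obtain T where T: "T \<in> Ti" "y \<in> T" using yTi by blast
    have single: "y \<notin> T'" if "T' \<in> Ti" "T' \<noteq> T" for T'
    proof
      assume "y \<in> T'"
      have "\<not> y extreme_point_of T" using y(2) T(1) by (auto simp: E_def)
      hence "y \<in> interior (T \<union> T')"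
        using two_triangles_surround[OF Th(2), of T T' y] T that partition(1) \<open>y \<in> T'\<close> by auto
      moreover have "interior (T \<union> T') \<subseteq> interior (\<Union>Ti)" by (rule interior_mono) (use T that in blast)
      ultimately show False using False by blast
    qed
    have yO: "y \<in> interior Omega" using yTi compactly_inside by blast
    have "y \<notin> interior (per (\<Union>Ti))"
    proof
      assume "y \<in> interior (per (\<Union>Ti))"
      hence "y \<in> interior (per (\<Union>Ti) \<inter> interior Omega)" using yO by (simp add: interior_open)
      moreover have "per (\<Union>Ti) \<inter> interior Omega \<subseteq> \<Union>Ti"
        using per_subset_period_eq_0[of "\<Union>Ti"] compactly_inside interior_subset closure_subset by blast
      ultimately show False using False interior_mono by blast
    qed
    hence "y \<in> frontier (per (\<Union>Ti))"
      using yTi subset_per closure_subset by (fastforce simp: frontier_def)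
    hence "chi_i Ti T y = 1" using T(2) by (simp add: chi_i_def)
    moreover have "chi_i Ti T' y = 0" if "T' \<in> Ti" "T' \<noteq> T" for T'
      using chi_i_outside single[OF that] inner_triangle(5)[of T'] that(1) by blast
    ultimately have "(\<Sum>T'\<in>Ti. chi_i Ti T' y) = (\<Sum>T'\<in>Ti. if T' = T then 1 else 0)"
      by (intro sum.cong) auto
    thus ?thesis using T(1) finite_parts(2) by simp
  qed
qed

text \<open>Every bond distributes exactly its own stress among the triangles it meets, so that summing over
  the triangles recovers the sum over the bonds.\<close>

lemma total_inner_stress:
  "(\<Sum>T\<in>Ta \<union> Ti. area T *\<^sub>R stress_value F T) =
     (eps N)\<^sup>2 *\<^sub>R (\<Sum>x\<in>sites_a N R Ta. \<Sum>r\<in>R. site_stress F r) +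
     (eps N)\<^sup>2 *\<^sub>R (\<Sum>b\<in>bonds_i N R Ti. bond_stress F b)"
proof -
  let ?S = "\<lambda>T. \<Sum>r\<in>R. \<Sum>x\<in>sites_a N R Ta. bond_avg (chi T) x (x + eps N *\<^sub>R r) *\<^sub>R site_stress F r"
  let ?B = "\<lambda>T. \<Sum>b\<in>bonds_i N R Ti. bond_avg (chi_i Ti T) (fst b) (fst b + eps N *\<^sub>R snd b) *\<^sub>R bond_stress F b"
  have "(\<Sum>T\<in>Ta \<union> Ti. area T *\<^sub>R stress_value F T) =
      (\<Sum>T\<in>Ta. area T *\<^sub>R stress_value F T) + (\<Sum>T\<in>Ti. area T *\<^sub>R stress_value F T)"
    using finite_parts partition by (intro sum.union_disjoint) auto
  also have "\<dots> = (eps N)\<^sup>2 *\<^sub>R (\<Sum>T\<in>Ta. ?S T) + ((eps N)\<^sup>2 *\<^sub>R (\<Sum>T\<in>Ti. ?S T) + (eps N)\<^sup>2 *\<^sub>R (\<Sum>T\<in>Ti. ?B T))"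
    by (simp add: stress_value_atomistic stress_value_interface scaleR_sum_right sum.distrib)
  also have "\<dots> = (eps N)\<^sup>2 *\<^sub>R ((\<Sum>T\<in>Ta. ?S T) + (\<Sum>T\<in>Ti. ?S T)) + (eps N)\<^sup>2 *\<^sub>R (\<Sum>T\<in>Ti. ?B T)"
    by (simp only: scaleR_add_right add.assoc)
  also have "(\<Sum>T\<in>Ta. ?S T) + (\<Sum>T\<in>Ti. ?S T) = (\<Sum>T\<in>Ta \<union> Ti. ?S T)"
    using finite_parts partition by (intro sum.union_disjoint[symmetric]) auto
  also have "\<dots> = (\<Sum>r\<in>R. \<Sum>x\<in>sites_a N R Ta. \<Sum>T\<in>Ta \<union> Ti. bond_avg (chi T) x (x + eps N *\<^sub>R r) *\<^sub>R site_stress F r)"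
    by (subst sum.swap, intro sum.cong refl, rule sum.swap)
  also have "\<dots> = (\<Sum>r\<in>R. \<Sum>x\<in>sites_a N R Ta. site_stress F r)"
  proof (intro sum.cong refl)
    fix r x assume "r \<in> R" "x \<in> sites_a N R Ta"
    thus "(\<Sum>T\<in>Ta \<union> Ti. bond_avg (chi T) x (x + eps N *\<^sub>R r) *\<^sub>R site_stress F r) = site_stress F r"
      using sum_bond_avg_site by (simp only: scaleR_left.sum[symmetric]) simp
  qed
  also have "\<dots> = (\<Sum>x\<in>sites_a N R Ta. \<Sum>r\<in>R. site_stress F r)" by (rule sum.swap)
  also have "(\<Sum>T\<in>Ti. ?B T) = (\<Sum>b\<in>bonds_i N R Ti. \<Sum>T\<in>Ti.
      bond_avg (chi_i Ti T) (fst b) (fst b + eps N *\<^sub>R snd b) *\<^sub>R bond_stress F b)"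
    by (rule sum.swap)
  also have "\<dots> = (\<Sum>b\<in>bonds_i N R Ti. bond_stress F b)"
  proof (intro sum.cong refl)
    fix b assume "b \<in> bonds_i N R Ti"
    thus "(\<Sum>T\<in>Ti. bond_avg (chi_i Ti T) (fst b) (fst b + eps N *\<^sub>R snd b) *\<^sub>R bond_stress F b) = bond_stress F b"
      using sum_bond_avg_interface by (simp only: scaleR_left.sum[symmetric]) simp
  qed
  finally show ?thesis .
qed

lemma stress_eq_stress_value:
  assumes T: "T \<in> Teps N d" and x: "x \<in> interior T"
  shows "stress N d R V Ei Ta Ti Tc (yhom F) x = stress_value F T"
proof -
  have "(THE T. T \<in> Teps N d \<and> x \<in> interior T) = T"
  proof (rule the_equality)
    fix T' assume "T' \<in> Teps N d \<and> x \<in> interior T'"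
    thus "T' = T"
      using fine_triangle_unique[OF N, of T' d x] fine_triangle_unique[OF N, of T d x] T x
      by (simp add: Teps_def)
  qed (use T x in simp)
  thus ?thesis using T x by (auto simp: stress_def)
qed

text \<open>A fine triangle that is none of the discrete ones does not overlap them and is therefore covered
  by coarse triangles of the continuum region, even if it crosses their edges.\<close>

lemma stress_continuum:
  assumes x: "x \<in> Omega" "x \<notin> \<Union>(Ta \<union> Ti)" and edge: "x \<notin> (\<Union>T\<in>Teps_per N d. frontier T)"
  shows "stress N d R V Ei Ta Ti Tc (yhom F) x = dW V F"
proof -
  obtain T where T: "T \<in> Teps N d" "x \<in> interior T"
    using fine_triangle_in_cell[OF N x(1) edge] by blast
  have xT: "x \<in> T" using T(2) interior_subset by blast
  have Tper: "T \<in> Teps_per N d" "T \<subseteq> closure Omega" using T(1) by (auto simp: Teps_def)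
  have "interior T \<subseteq> \<Union>Tc"
  proof
    fix y assume y: "y \<in> interior T"
    have "y \<notin> T'" if T': "T' \<in> Ta \<union> Ti" for T'
    proof
      assume "y \<in> T'"
      hence "T' \<inter> interior T \<noteq> {}" using y by blast
      moreover have "T' \<subseteq> closure (interior T')"
        using inner_triangle(1,4)[OF T'] triangulation_interior[OF Th(2)] convex_closure_interior closure_subset
        by metis
      ultimately have "interior T' \<inter> interior T \<noteq> {}"
        using open_Int_closure_eq_empty[OF open_interior, of T "interior T'"] by blast
      then obtain z where z: "z \<in> interior T'" "z \<in> interior T" by blast
      have "T' \<in> Teps_per N d" using T' fine by (auto simp: Teps_def)
      hence "T' = T"
        using fine_triangle_unique[OF N _ z(1)] fine_triangle_unique[OF N Tper(1) z(2)] by simp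
      thus False using x(2) xT T' by blast
    qed
    moreover have "y \<in> \<Union>Th"
      using y interior_subset Tper(2) Th(2) by (auto simp: regular_triangulation_def)
    ultimately show "y \<in> \<Union>Tc" using partition(1) by blast
  qed
  moreover have "closed (\<Union>Tc)"
    using finite_parts(3) triangulation_closed[OF Th(2)] partition(1) by (intro closed_Union) auto
  ultimately have "T \<subseteq> \<Union>Tc"
    using convex_subset_closure_interior[OF fine_triangle_convex[OF Tper(1)]] T(2) by blast
  moreover have "\<not> T \<subseteq> \<Union>Ta" using x(2) xT by blast
  moreover have "grad_on (yhom F) T = F" using grad_on_yhom T(2) by blast
  ultimately have "stress_value F T = dW V F" by (simp add: stress_on_def)
  thus ?thesis using stress_eq_stress_value[OF T] by simp
qed

lemma stress_integral:
  "integral Omega (stress N d R V Ei Ta Ti Tc (yhom F)) =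
     area Omega *\<^sub>R dW V F + (\<Sum>T\<in>Ta \<union> Ti. area T *\<^sub>R (stress_value F T - dW V F))"
proof -
  let ?s = "stress N d R V Ei Ta Ti Tc (yhom F)"
  have "((\<lambda>x. if x \<in> Omega then ?s x - dW V F else 0)
     has_integral (\<Sum>T\<in>Ta \<union> Ti. area T *\<^sub>R (stress_value F T - dW V F))) UNIV"
  proof (rule has_integral_piecewise_constant[OF Th(2) _ _ negligible_fine_edges])
    show "Ta \<union> Ti \<subseteq> Th" "finite (Ta \<union> Ti)" using partition finite_parts by auto
    show "(if x \<in> Omega then ?s x - dW V F else 0) = stress_value F T - dW V F"
      if T: "T \<in> Ta \<union> Ti" and x: "x \<in> interior T" for T x
    proof -
      have "x \<in> Omega" using x inner_triangle(2)[OF T] interior_subset by blast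
      moreover have "T \<in> Teps N d" using T fine by blast
      ultimately show ?thesis using stress_eq_stress_value[OF _ x] by simp
    qed
    show "(if x \<in> Omega then ?s x - dW V F else 0) = 0"
      if "x \<notin> \<Union>(Ta \<union> Ti)" "x \<notin> (\<Union>T\<in>Teps_per N d. frontier T)" for x
      using stress_continuum[OF _ that] by simp
  qed
  hence 1: "((\<lambda>x. ?s x - dW V F) has_integral (\<Sum>T\<in>Ta \<union> Ti. area T *\<^sub>R (stress_value F T - dW V F))) Omega"
    by (simp only: has_integral_restrict_UNIV)
  have "(indicat_real Omega has_integral area Omega) UNIV"
    unfolding area_def using Omega_lmeasurable lmeasurable_iff_has_integral by blast
  hence "((\<lambda>x. indicat_real Omega x *\<^sub>R dW V F) has_integral area Omega *\<^sub>R dW V F) UNIV"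
    by (rule has_integral_scaleR_left)
  moreover have "(\<lambda>x. indicat_real Omega x *\<^sub>R dW V F) = (\<lambda>x. if x \<in> Omega then dW V F else 0)"
    by auto
  ultimately have 2: "((\<lambda>x. dW V F) has_integral area Omega *\<^sub>R dW V F) Omega"
    by (simp only: has_integral_restrict_UNIV)
  show ?thesis using has_integral_add[OF 2 1] by (simp add: integral_unique)
qed

lemma mean_stress:
  assumes "patch_test_consistent N Th (E_ac N R V Ei Ta Tc)"
  shows "(1 / area Omega) *\<^sub>R integral Omega (stress N d R V Ei Ta Ti Tc (yhom F)) = dW V F"
proof -
  have "(\<Sum>T\<in>Ta \<union> Ti. area T *\<^sub>R (stress_value F T - dW V F)) =
      (\<Sum>T\<in>Ta \<union> Ti. area T *\<^sub>R stress_value F T) - (\<Sum>T\<in>Ta \<union> Ti. area T) *\<^sub>R dW V F"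
    by (simp add: scaleR_diff_right sum_subtractf scaleR_left.sum)
  also have "\<dots> = 0"
    unfolding total_inner_stress patch_test_balance[OF assms] by simp
  finally show ?thesis using area_Omega_pos by (simp add: stress_integral)
qed

end

theorem proposition6p13:
  fixes N :: nat and d :: bool and R :: "vec2 set"
    and V :: "(vec2 \<Rightarrow> vec2) \<Rightarrow> real"
    and Ei :: "(vec2 \<times> vec2 \<Rightarrow> vec2) \<Rightarrow> real"
    and Th Ta Ti Tc :: "vec2 set set"
  assumes N: "N \<ge> 1"
    and R: "finite R" "R \<subseteq> Z2 - {0}"
    and V: "C2_fun R V" "bounded_second_partials R V"
    and mesh: "coarse_mesh N Th"
    and partition: "Th = Ta \<union> Ti \<union> Tc" "Ta \<inter> Ti = {}" "Ta \<inter> Tc = {}" "Ti \<inter> Tc = {}"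
    and Ei: "C2_fun (bonds_i N R Ti) Ei"
    and fine: "Ta \<union> Ti \<subseteq> Teps N d"
    and range_a: "\<forall>x\<in>sites_a N R Ta. \<forall>r\<in>R.
                    closed_segment x (x + eps N *\<^sub>R r) \<subseteq> \<Union>Ta \<union> \<Union>Ti"
    and nondegenerate: "no_bond_along_boundary N R Ta Ti"
    and compactly_inside: "\<Union>Ta \<union> \<Union>Ti \<subseteq> interior Omega"
    and patch: "patch_test_consistent N Th (E_ac N R V Ei Ta Tc)"
  shows "\<forall>F. (1 / area Omega) *\<^sub>R integral Omega (stress N d R V Ei Ta Ti Tc (yhom F)) = dW V F"
proof -
  interpret coupling N d R V Ei Th Ta Ti Tc
  proof
    show "C1_fun R V" using V(1) by (simp add: C2_fun_def)
    show "C1_fun (bonds_i N R Ti) Ei" using Ei by (simp add: C2_fun_def)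
    show "finite Th" "regular_triangulation Th (closure Omega)" using mesh by (auto simp: coarse_mesh_def)
    show "closed_segment x (x + eps N *\<^sub>R r) \<subseteq> \<Union>Ta \<union> \<Union>Ti" if "x \<in> sites_a N R Ta" "r \<in> R" for x r
      using range_a that by blast
  qed (fact N R partition fine nondegenerate compactly_inside)+
  show ?thesis using mean_stress[OF patch] by blast
qed

end
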